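(* Let $f_{xxx}$ be a ternary cubic form over $\mathbb{C}$. The following are equivalent: (1) $S\neq 0$. (2) $f_{xxx}=a_x^3+b_x^3+c_x^3+d_x^3$ for some linear forms $a_x,b_x,c_x,d_x$ that are triplewise independent (any three of the four are linearly independent). Moreover, when these conditions hold, $\operatorname{rank}[f_{xxx}]=4$.
   Context: All forms are homogeneous polynomials with complex coefficients in $x_1,x_2,x_3$ (the zero polynomial is allowed); subscripts indicate degree, so $a_x=a_1x_1+a_2x_2+a_3x_3$ is a linear form and $f_{xxx}$ a cubic form. Let $u_1,u_2,u_3$ be further independent variables and $u_x=u_1x_1+u_2x_2+u_3x_3$. Rank: for a form $f$ of degree $d$, $\operatorname{rank}[f]$ (Waring rank) is the smallest integer $r\ge 0$ such that $f$ is a sum of $r$ $d$-th powers of linear forms in $\mathbb{C}[x_1,x_2,x_3]$. Transvectants: for forms $f,g,h$ in $x_1,x_2,x_3$ (whose coefficients may be polynomials in $u_1,u_2,u_3$, treated as constants), $\mathcal{J}_n[f,g,h]$ is obtained by applying $\Omega^n$ to $f(x)g(y)h(z)$, where $x,y,z$ are three independent triples of variables and $\Omega$ is the differential operator given by the $3\times 3$ determinant with rows $(\partial/\partial x_i)_i$, $(\partial/\partial y_i)_i$, $(\partial/\partial z_i)_i$, and then setting $y=z=x$. Concomitants of $f_{xxx}$: $S_{uuu}=\frac1{576}\mathcal{J}_4[f_{xxx}u_x,f_{xxx}u_x,f_{xxx}u_x]$ (a cubic form in $u_1,u_2,u_3$). The Aronhold invariant $S\in\mathbb{C}$ is obtained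 from $S_{uuu}$ by the substitution $u^3\mapsto f$ replacing the coefficients of $u_x^3$ by the corresponding coefficients of $f_{xxx}$: i.e. the linear substitution on cubic monomials in $u$ sending $\frac{3!}{i!\,j!\,k!}u_1^iu_2^ju_3^k$ ($i+j+k=3$) to the coefficient of $x_1^ix_2^jx_3^k$ in $f_{xxx}$. *)

theory Defs
  imports "HOL-Analysis.Analysis" "HOL-Library.Poly_Mapping"
begin

text \<open>
  Polynomials over the complex numbers in the four triples of variables
  \<open>X i\<close>, \<open>Y i\<close>, \<open>Z i\<close>, \<open>U i\<close>, as finitely supported maps from monomials to coefficients.
  The index \<open>i\<close> ranges over the three-element type \<open>3\<close>, whose elements are written \<open>1, 2, 3\<close>
  (with \<open>3 = 0\<close> there).
\<close>

datatype var = X "3" | Y "3" | Z "3" | U "3"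

type_synonym pol = "(var \<Rightarrow>\<^sub>0 nat) \<Rightarrow>\<^sub>0 complex"

definition Const :: "complex \<Rightarrow> pol" where
  "Const c = Poly_Mapping.single 0 c"

definition Var :: "var \<Rightarrow> pol" where
  "Var v = Poly_Mapping.single (Poly_Mapping.single v 1) 1"

text \<open>Simultaneous substitution of polynomials for the variables.\<close>

definition psubst :: "(var \<Rightarrow> pol) \<Rightarrow> pol \<Rightarrow> pol" where
  "psubst \<sigma> p =
     (\<Sum>m\<in>Poly_Mapping.keys p.
        Const (Poly_Mapping.lookup p m) *
        (\<Prod>v\<in>Poly_Mapping.keys m. \<sigma> v ^ Poly_Mapping.lookup m v))"

text \<open>
  Formal partial derivative.  When \<open>v\<close> does not occur in \<open>m\<close>, the exponent subtraction
  truncates, but then the coefficient is \<open>0\<close>.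
\<close>

definition pd :: "var \<Rightarrow> pol \<Rightarrow> pol" where
  "pd v p =
     (\<Sum>m\<in>Poly_Mapping.keys p.
        Poly_Mapping.single (m - Poly_Mapping.single v 1)
          (of_nat (Poly_Mapping.lookup m v) * Poly_Mapping.lookup p m))"

text \<open>Homogeneous polynomials of degree \<open>d\<close> in \<open>X 1, X 2, X 3\<close> only; includes \<open>0\<close>.\<close>

definition ternary_form :: "nat \<Rightarrow> pol \<Rightarrow> bool" where
  "ternary_form d f \<longleftrightarrow>
     (\<forall>m\<in>Poly_Mapping.keys f.
        Poly_Mapping.keys m \<subseteq> {X 1, X 2, X 3} \<and>
        Poly_Mapping.lookup m (X 1) + Poly_Mapping.lookup m (X 2) + Poly_Mapping.lookup m (X 3) = d)"

definition independent3 :: "pol \<Rightarrow> pol \<Rightarrow> pol \<Rightarrow> bool" where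
  "independent3 a b c \<longleftrightarrow>
     (\<forall>\<alpha> \<beta> \<gamma>. Const \<alpha> * a + Const \<beta> * b + Const \<gamma> * c = 0 \<longrightarrow> \<alpha> = 0 \<and> \<beta> = 0 \<and> \<gamma> = 0)"

definition triplewise_independent :: "pol \<Rightarrow> pol \<Rightarrow> pol \<Rightarrow> pol \<Rightarrow> bool" where
  "triplewise_independent a b c d \<longleftrightarrow>
     independent3 a b c \<and> independent3 a b d \<and> independent3 a c d \<and> independent3 b c d"

definition waring_rank :: "nat \<Rightarrow> pol \<Rightarrow> nat" where
  "waring_rank d f =
     (LEAST r. \<exists>l :: nat \<Rightarrow> pol. (\<forall>i<r. ternary_form 1 (l i)) \<and> f = (\<Sum>i<r. l i ^ d))"

text \<open>The determinant with rows \<open>(pd (X i))\<close>, \<open>(pd (Y i))\<close>, \<open>(pd (Z i))\<close>, expanded.\<close>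

definition Omega :: "pol \<Rightarrow> pol" where
  "Omega F =
      pd (X 1) (pd (Y 2) (pd (Z 3) F)) - pd (X 1) (pd (Y 3) (pd (Z 2) F))
    + pd (X 2) (pd (Y 3) (pd (Z 1) F)) - pd (X 2) (pd (Y 1) (pd (Z 3) F))
    + pd (X 3) (pd (Y 1) (pd (Z 2) F)) - pd (X 3) (pd (Y 2) (pd (Z 1) F))"

fun to_Y :: "var \<Rightarrow> pol" where
  "to_Y (X i) = Var (Y i)"
| "to_Y v = Var v"

fun to_Z :: "var \<Rightarrow> pol" where
  "to_Z (X i) = Var (Z i)"
| "to_Z v = Var v"

fun to_X :: "var \<Rightarrow> pol" where
  "to_X (Y i) = Var (X i)"
| "to_X (Z i) = Var (X i)"
| "to_X v = Var v"

text \<open>Meant for arguments in which only the variables \<open>X i\<close> and \<open>U i\<close> occur.\<close>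

definition transvectant :: "nat \<Rightarrow> pol \<Rightarrow> pol \<Rightarrow> pol \<Rightarrow> pol" where
  "transvectant n f g h = psubst to_X ((Omega ^^ n) (f * psubst to_Y g * psubst to_Z h))"

definition u_x :: pol where
  "u_x = Var (U 1) * Var (X 1) + Var (U 2) * Var (X 2) + Var (U 3) * Var (X 3)"

definition S_uuu :: "pol \<Rightarrow> pol" where
  "S_uuu f = Const (1 / 576) * transvectant 4 (f * u_x) (f * u_x) (f * u_x)"

definition monom3 :: "(3 \<Rightarrow> var) \<Rightarrow> nat \<Rightarrow> nat \<Rightarrow> nat \<Rightarrow> (var \<Rightarrow>\<^sub>0 nat)" where
  "monom3 V i j k =
     Poly_Mapping.single (V 1) i + Poly_Mapping.single (V 2) j + Poly_Mapping.single (V 3) k"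

text \<open>
  The linear substitution \<open>u\<^sup>3 \<mapsto> f\<close> on cubic forms \<open>\<phi>\<close> in the \<open>U i\<close>: it sends
  \<open>3! / (i! j! k!) u\<^sub>1\<^sup>i u\<^sub>2\<^sup>j u\<^sub>3\<^sup>k\<close>, which is the coefficient of
  \<open>x\<^sub>1\<^sup>i x\<^sub>2\<^sup>j x\<^sub>3\<^sup>k\<close> in \<open>u_x\<^sup>3\<close>, to the coefficient of the same monomial in \<open>f\<close>.
\<close>

definition subst_u3 :: "pol \<Rightarrow> pol \<Rightarrow> complex" where
  "subst_u3 f \<phi> =
     (\<Sum>(i, j, k) \<in> {(i, j, k). i + j + k = 3}.
        Poly_Mapping.lookup \<phi> (monom3 U i j k) * (fact i * fact j * fact k / fact 3) *
        Poly_Mapping.lookup f (monom3 X i j k))"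

definition aronhold_S :: "pol \<Rightarrow> complex" where
  "aronhold_S f = subst_u3 f (S_uuu f)"

end

(* The Aronhold invariant is the diagonal of a quadrilinear form which on four cubes a^3, b^3, c^3, d^3
   takes the value 9 [abc][dbc][adc][abd]: Omega acts on products of powers of linear forms by
   producing brackets. So S of a sum of four cubes is, up to a nonzero constant, the product of the
   four brackets; with d = 0 this also shows that three cubes do not suffice when S is nonzero.

   Conversely, let F be the polarisation of f. The determinant of the polar F(p, -, -) has a zero p on
   a line, so F(p, v, -) = 0 for some nonzero v. If p and v are independent, f = g(x, z) + h(y, z) in
   suitable linear forms. Moving a multiple of z^3 from g to h makes both binary cubics sums of two
   cubes, unless one of them has the form (linear) z^2. Then S(f) = 0: for f = x z^2 + A y^3 + B y^2 z
   with A nonzero, f is a sum of four cubes of which three are dependent, and the case A = 0 follows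
   because S(f + t y^3) is affine in t. If p and v are parallel, diagonalising the quadratic form
   F(p, -, -) yields an independent pair. *)

theory Submission
  imports Defs "HOL-Computational_Algebra.Fundamental_Theorem_Algebra"
begin

section \<open>Polynomials and ternary forms\<close>


lemma poly_mapping_sum_single:
  fixes p :: "'a \<Rightarrow>\<^sub>0 'b::comm_monoid_add"
  assumes "finite A" "Poly_Mapping.keys p \<subseteq> A"
  shows "p = (\<Sum>m\<in>A. Poly_Mapping.single m (Poly_Mapping.lookup p m))"
proof (rule poly_mapping_eqI)
  fix k
  have "Poly_Mapping.lookup p k = (if k \<in> A then Poly_Mapping.lookup p k else 0)"
    using assms(2) by (auto simp: in_keys_iff)
  also have "\<dots> = (\<Sum>m\<in>A. if k = m then Poly_Mapping.lookup p m else 0)"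
    using assms(1) by (simp add: sum.delta)
  also have "\<dots> = Poly_Mapping.lookup (\<Sum>m\<in>A. Poly_Mapping.single m (Poly_Mapping.lookup p m)) k"
    by (auto simp: lookup_sum lookup_single when_def intro!: sum.cong)
  finally show "Poly_Mapping.lookup p k = \<dots>" .
qed

text \<open>Reduces claims that are additive in a polynomial to single monomials; the product rules
  for \<open>pd\<close> and \<open>psubst\<close> are obtained this way.\<close>

lemma pol_induct [case_names single add]:
  fixes p :: "'a \<Rightarrow>\<^sub>0 'b::comm_monoid_add"
  assumes single: "\<And>m c. P (Poly_Mapping.single m c)"
    and add: "\<And>p q. P p \<Longrightarrow> P q \<Longrightarrow> P (p + q)"
  shows "P p"
proof -
  have "P (\<Sum>m\<in>A. Poly_Mapping.single m (Poly_Mapping.lookup p m))" if "finite A" for A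
    using that
  proof induction
    case empty
    show ?case using single[of undefined 0] by simp
  next
    case (insert x F)
    then show ?case by (simp add: add single)
  qed
  then show ?thesis
    using poly_mapping_sum_single[of "Poly_Mapping.keys p" p] by (metis finite_keys order_refl)
qed

lemma Const_0 [simp]: "Const 0 = 0" and Const_1 [simp]: "Const 1 = 1"
  by (simp_all add: Const_def)

lemma Const_add: "Const (a + b) = Const a + Const b"
  and Const_minus: "Const (- a) = - Const a"
  and Const_diff: "Const (a - b) = Const a - Const b"
  and Const_mult: "Const (a * b) = Const a * Const b"
  by (simp_all add: Const_def single_add single_uminus single_diff mult_single)

lemma Const_power: "Const (a ^ n) = Const a ^ n"
  by (induction n) (simp_all add: Const_mult)

lemma Const_numeral [simp]: "Const (numeral n) = numeral n"
  by (simp add: Const_def)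

lemma Const_of_nat: "Const (of_nat n) = of_nat n"
  by (simp add: Const_def)

lemmas Const_hom = Const_add Const_minus Const_diff Const_mult Const_power Const_of_nat

lemma lookup_Const_mult: "Poly_Mapping.lookup (Const c * p) m = c * Poly_Mapping.lookup p m"
proof -
  have "Const c * p = Poly_Mapping.map ((*) c) p"
    by (simp add: Const_def mult_map_scale_conv_mult)
  then show ?thesis by (simp add: Poly_Mapping.map.rep_eq when_def)
qed

section \<open>Formal differentiation and substitution\<close>

lemma pd_superset:
  assumes "finite A" "Poly_Mapping.keys p \<subseteq> A"
  shows "pd v p = (\<Sum>m\<in>A. Poly_Mapping.single (m - Poly_Mapping.single v 1)
           (of_nat (Poly_Mapping.lookup m v) * Poly_Mapping.lookup p m))"
  unfolding pd_def using assms by (intro sum.mono_neutral_left) (auto simp: in_keys_iff)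

text \<open>The defining sum of \<open>pd\<close> ranges over the support of its argument, and
  cancellation can shrink the support of p + q. All three sums are therefore taken over one common
  superset, where the extra terms vanish.\<close>

lemma pd_add: "pd v (p + q) = pd v p + pd v q"
proof -
  let ?A = "Poly_Mapping.keys p \<union> Poly_Mapping.keys q"
  have "Poly_Mapping.keys (p + q) \<subseteq> ?A" by (rule keys_add)
  then show ?thesis
    by (subst (1 2 3) pd_superset[where A = ?A])
      (auto simp: lookup_add distrib_left single_add sum.distrib)
qed

lemma pd_single: "pd v (Poly_Mapping.single m c) =
    Poly_Mapping.single (m - Poly_Mapping.single v 1) (of_nat (Poly_Mapping.lookup m v) * c)"
  by (subst pd_superset[where A = "{m}"]) auto

lemma pd_0 [simp]: "pd v 0 = 0"
  by (simp add: pd_def)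

lemma pd_mult: "pd v (p * q) = pd v p * q + p * pd v q"
proof (induction p rule: pol_induct)
  case (single m c)
  show ?case
  proof (induction q rule: pol_induct)
    case (single n d)
    let ?s = "Poly_Mapping.single v (1::nat)"
    \<comment> \<open>Exponent subtraction truncates, so it can be moved across a sum only when v
      occurs in the monomial. When it does not, the coefficient in \<open>1\<close> or
      \<open>2\<close> is 0.\<close>
    have e: "m' + n' - ?s = (m' - ?s) + n'" if "Poly_Mapping.lookup m' v \<noteq> 0" for m' n'
      using that by (intro poly_mapping_eqI) (auto simp: lookup_add lookup_minus lookup_single when_def)
    have 1: "Poly_Mapping.single (m - ?s + n) (of_nat (Poly_Mapping.lookup m v) * c * d)
      = Poly_Mapping.single (m + n - ?s) (of_nat (Poly_Mapping.lookup m v) * c * d)"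
      using e[of m n] by (cases "Poly_Mapping.lookup m v = 0") auto
    have 2: "Poly_Mapping.single (m + (n - ?s)) (c * (of_nat (Poly_Mapping.lookup n v) * d))
      = Poly_Mapping.single (m + n - ?s) (c * (of_nat (Poly_Mapping.lookup n v) * d))"
      using e[of n m] by (cases "Poly_Mapping.lookup n v = 0") (auto simp: add.commute)
    show ?case
      unfolding mult_single pd_single 1 2 single_add[symmetric]
      by (simp add: lookup_add algebra_simps)
  qed (simp add: pd_add algebra_simps)
qed (simp add: pd_add algebra_simps)

lemma pd_Const [simp]: "pd v (Const c) = 0"
  by (simp add: Const_def pd_single)

lemma pd_1 [simp]: "pd v 1 = 0"
  using pd_Const[of v 1] by (simp del: pd_Const)

lemma pd_Var: "pd v (Var w) = (if v = w then 1 else 0)"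
  by (auto simp: Var_def pd_single lookup_single when_def)

lemma pd_power: "pd v (p ^ n) = of_nat n * p ^ (n - 1) * pd v p"
proof (induction n)
  case (Suc n)
  then show ?case by (cases n) (simp_all add: pd_mult algebra_simps)
qed simp

lemma pd_of_nat [simp]: "pd v (of_nat n) = 0"
  using pd_Const[of v "of_nat n"] by (simp add: Const_of_nat del: pd_Const)

lemma psubst_superset:
  assumes "finite A" "Poly_Mapping.keys p \<subseteq> A"
  shows "psubst \<sigma> p = (\<Sum>m\<in>A. Const (Poly_Mapping.lookup p m) *
        (\<Prod>v\<in>Poly_Mapping.keys m. \<sigma> v ^ Poly_Mapping.lookup m v))"
  unfolding psubst_def using assms by (intro sum.mono_neutral_left) (auto simp: in_keys_iff)

lemma psubst_add: "psubst \<sigma> (p + q) = psubst \<sigma> p + psubst \<sigma> q"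
proof -
  let ?A = "Poly_Mapping.keys p \<union> Poly_Mapping.keys q"
  have "Poly_Mapping.keys (p + q) \<subseteq> ?A" by (rule keys_add)
  then show ?thesis
    by (subst (1 2 3) psubst_superset[where A = ?A])
      (auto simp: lookup_add distrib_right Const_add sum.distrib)
qed

lemma psubst_single: "psubst \<sigma> (Poly_Mapping.single m c) =
    Const c * (\<Prod>v\<in>Poly_Mapping.keys m. \<sigma> v ^ Poly_Mapping.lookup m v)"
  by (subst psubst_superset[where A = "{m}"]) auto

lemma psubst_monomial_add:
  fixes \<sigma> :: "'v \<Rightarrow> 'a::comm_monoid_mult" and m n :: "'v \<Rightarrow>\<^sub>0 nat"
  shows "(\<Prod>v\<in>Poly_Mapping.keys (m + n). \<sigma> v ^ Poly_Mapping.lookup (m + n) v) =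
    (\<Prod>v\<in>Poly_Mapping.keys m. \<sigma> v ^ Poly_Mapping.lookup m v) *
    (\<Prod>v\<in>Poly_Mapping.keys n. \<sigma> v ^ Poly_Mapping.lookup n v)"
proof -
  let ?A = "Poly_Mapping.keys m \<union> Poly_Mapping.keys n"
  have "(\<Prod>v\<in>Poly_Mapping.keys k. \<sigma> v ^ Poly_Mapping.lookup k v) =
        (\<Prod>v\<in>?A. \<sigma> v ^ Poly_Mapping.lookup k v)" if "Poly_Mapping.keys k \<subseteq> ?A" for k
    using that by (intro prod.mono_neutral_left) (auto simp: in_keys_iff)
  from this[of m] this[of n] this[of "m + n"] show ?thesis
    using keys_add[of m n] by (simp add: lookup_add power_add prod.distrib)
qed

lemma psubst_mult: "psubst \<sigma> (p * q) = psubst \<sigma> p * psubst \<sigma> q"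
proof (induction p rule: pol_induct)
  case (single m c)
  show ?case
    by (induction q rule: pol_induct)
      (simp_all add: mult_single psubst_single psubst_monomial_add Const_mult psubst_add algebra_simps)
qed (simp add: psubst_add algebra_simps)

lemma psubst_Const [simp]: "psubst \<sigma> (Const c) = Const c"
  by (simp add: Const_def psubst_single)

lemma psubst_1 [simp]: "psubst \<sigma> 1 = 1"
  using psubst_Const[of \<sigma> 1] by (simp del: psubst_Const)

lemma psubst_Var [simp]: "psubst \<sigma> (Var v) = \<sigma> v"
  by (simp add: Var_def psubst_single)

lemma psubst_power: "psubst \<sigma> (p ^ n) = psubst \<sigma> p ^ n"
  by (induction n) (simp_all add: psubst_mult)

section \<open>Ternary forms in coordinates\<close>

lemma ternary_form_0 [simp]: "ternary_form d 0"
  by (simp add: ternary_form_def)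

lemma ternary_form_add: "ternary_form d p \<Longrightarrow> ternary_form d q \<Longrightarrow> ternary_form d (p + q)"
  unfolding ternary_form_def using keys_add[of p q] by blast

lemma ternary_form_Const_mult: "ternary_form d p \<Longrightarrow> ternary_form d (Const c * p)"
  unfolding ternary_form_def by (auto simp: in_keys_iff lookup_Const_mult)

lemma ternary_form_minus: "ternary_form d p \<Longrightarrow> ternary_form d (- p)"
  using ternary_form_Const_mult[of d p "- 1"] by (simp add: Const_minus)

lemma ternary_form_diff: "ternary_form d p \<Longrightarrow> ternary_form d q \<Longrightarrow> ternary_form d (p - q)"
  using ternary_form_add[of d p "- q"] by (simp add: ternary_form_minus)

lemma ternary_form_Var: "i \<in> {1, 2, 3} \<Longrightarrow> ternary_form 1 (Var (X i))"
  unfolding ternary_form_def Var_def by (auto simp: lookup_single when_def)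

lemmas ternary_form_closed =
  ternary_form_add ternary_form_minus ternary_form_diff ternary_form_Const_mult

definition lin :: "complex ^ 3 \<Rightarrow> pol" where
  "lin v = Const (v$1) * Var (X 1) + Const (v$2) * Var (X 2) + Const (v$3) * Var (X 3)"

lemma lookup_monom3:
  assumes "inj V"
  shows "Poly_Mapping.lookup (monom3 V i j k) (V 1) = i"
    "Poly_Mapping.lookup (monom3 V i j k) (V 2) = j"
    "Poly_Mapping.lookup (monom3 V i j k) (V 3) = k"
  using assms by (simp_all add: monom3_def lookup_add lookup_single when_def inj_eq)

lemma monom3_eq_iff: "inj V \<Longrightarrow> monom3 V i j k = monom3 V i' j' k' \<longleftrightarrow> i = i' \<and> j = j' \<and> k = k'"
  by (metis lookup_monom3)

lemma inj_XU [simp]: "inj X" "inj U"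
  by (auto intro: injI)

lemma single_Var_power: "Poly_Mapping.single (Poly_Mapping.single v n) 1 = Var v ^ n"
proof (induction n)
  case (Suc n)
  have "Poly_Mapping.single (Poly_Mapping.single v (Suc n)) (1::complex)
     = Var v * Poly_Mapping.single (Poly_Mapping.single v n) 1"
    by (simp add: Var_def mult_single flip: single_add)
  then show ?case by (simp add: Suc)
qed simp

lemma single_monom3: "Poly_Mapping.single (monom3 V i j k) c =
    Const c * Var (V 1) ^ i * Var (V 2) ^ j * Var (V 3) ^ k"
  by (simp add: monom3_def Const_def mult_single flip: single_Var_power)

lemma lookup_monomial:
  assumes "inj V"
  shows "Poly_Mapping.lookup (Const c * Var (V 1) ^ i' * Var (V 2) ^ j' * Var (V 3) ^ k') (monom3 V i j k)
    = (if i = i' \<and> j = j' \<and> k = k' then c else 0)"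
  unfolding single_monom3[symmetric] using assms by (auto simp: lookup_single monom3_eq_iff when_def)

lemma finite_triples: "finite {(i, j, k). i + j + k = (d::nat)}"
  by (rule finite_subset[of _ "{..d} \<times> {..d} \<times> {..d}"]) auto

lemma ternary_form_expand:
  assumes "ternary_form d f"
  shows "f = (\<Sum>(i, j, k) \<in> {(i, j, k). i + j + k = d}.
    Const (Poly_Mapping.lookup f (monom3 X i j k)) * Var (X 1) ^ i * Var (X 2) ^ j * Var (X 3) ^ k)"
proof -
  let ?T = "{(i, j, k). i + j + k = d}" and ?g = "\<lambda>(i, j, k). monom3 X i j k"
  have inj: "inj_on ?g ?T" by (auto simp: inj_on_def monom3_eq_iff)
  have "Poly_Mapping.keys f \<subseteq> ?g ` ?T"
  proof
    fix m assume "m \<in> Poly_Mapping.keys f"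
    then have k: "Poly_Mapping.keys m \<subseteq> {X 1, X 2, X 3}"
      and s: "Poly_Mapping.lookup m (X 1) + Poly_Mapping.lookup m (X 2) + Poly_Mapping.lookup m (X 3) = d"
      using assms by (auto simp: ternary_form_def)
    have "m = monom3 X (Poly_Mapping.lookup m (X 1)) (Poly_Mapping.lookup m (X 2)) (Poly_Mapping.lookup m (X 3))"
    proof (rule poly_mapping_eqI)
      fix v
      show "Poly_Mapping.lookup m v = Poly_Mapping.lookup (monom3 X (Poly_Mapping.lookup m (X 1))
         (Poly_Mapping.lookup m (X 2)) (Poly_Mapping.lookup m (X 3))) v"
        using k by (cases "v \<in> {X 1, X 2, X 3}")
          (auto simp: lookup_monom3, auto simp: monom3_def lookup_add lookup_single when_def in_keys_iff)
    qed
    then show "m \<in> ?g ` ?T" using s by force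
  qed
  then have "f = (\<Sum>m\<in>?g ` ?T. Poly_Mapping.single m (Poly_Mapping.lookup f m))"
    by (intro poly_mapping_sum_single finite_imageI finite_triples)
  also have "\<dots> = (\<Sum>t\<in>?T. Poly_Mapping.single (?g t) (Poly_Mapping.lookup f (?g t)))"
    using inj by (simp add: sum.reindex)
  finally show ?thesis by (simp add: split_def single_monom3)
qed

lemma triples_1: "{(i, j, k). i + j + k = (1::nat)} = {(1,0,0), (0,1,0), (0,0,1)}"
  by auto

lemma triples_3: "{(i, j, k). i + j + k = (3::nat)} =
   {(3,0,0), (0,3,0), (0,0,3), (2,1,0), (2,0,1), (1,2,0), (0,2,1), (1,0,2), (0,1,2), (1,1,1)}"
proof -
  have "(i + j + k = (3::nat)) = ((i, j, k) \<in> {(3,0,0), (0,3,0), (0,0,3), (2,1,0), (2,0,1),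
      (1,2,0), (0,2,1), (1,0,2), (0,1,2), (1::nat,1::nat,1::nat)})" for i j k
    by (simp, presburger)
  then show ?thesis by auto
qed

lemma ternary_form_1_iff: "ternary_form 1 a \<longleftrightarrow> (\<exists>v. a = lin v)"
proof
  assume "ternary_form 1 a"
  then have "a = (\<Sum>(i, j, k) \<in> {(1,0,0), (0,1,0), (0,0,1)}.
    Const (Poly_Mapping.lookup a (monom3 X i j k)) * Var (X 1) ^ i * Var (X 2) ^ j * Var (X 3) ^ k)"
    using ternary_form_expand[of 1 a] unfolding triples_1 by blast
  also have "\<dots> = lin (vector [Poly_Mapping.lookup a (monom3 X 1 0 0),
     Poly_Mapping.lookup a (monom3 X 0 1 0), Poly_Mapping.lookup a (monom3 X 0 0 1)])"
    by (simp add: lin_def)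
  finally show "\<exists>v. a = lin v" by blast
next
  assume "\<exists>v. a = lin v"
  then show "ternary_form 1 a"
    unfolding lin_def by (elim exE, hypsubst) (intro ternary_form_closed ternary_form_Var; simp)
qed

section \<open>The Aronhold invariant of a sum of cubes\<close>


lemma pd_commute: "pd v (pd w p) = pd w (pd v p)"
proof (induction p rule: pol_induct)
  case (single m c)
  have "m - Poly_Mapping.single w 1 - Poly_Mapping.single v 1 = m - Poly_Mapping.single v 1 - Poly_Mapping.single w 1"
    by (rule poly_mapping_eqI) (simp add: lookup_minus)
  then show ?case
    by (cases "v = w") (simp_all add: pd_single lookup_minus lookup_single algebra_simps)
qed (simp add: pd_add)

text \<open>The ring is left general because rows consist of complex numbers, constant polynomials,
  partial derivatives, linear forms or the variables \<open>U i\<close>.\<close>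

definition det3 :: "(3 \<Rightarrow> 'a::comm_ring_1) \<Rightarrow> (3 \<Rightarrow> 'a) \<Rightarrow> (3 \<Rightarrow> 'a) \<Rightarrow> 'a" where
  "det3 a b c = a 1 * (b 2 * c 3 - b 3 * c 2) + a 2 * (b 3 * c 1 - b 1 * c 3)
     + a 3 * (b 1 * c 2 - b 2 * c 1)"

abbreviation bracket :: "complex ^ 3 \<Rightarrow> complex ^ 3 \<Rightarrow> complex ^ 3 \<Rightarrow> complex" where
  "bracket a b c \<equiv> det3 (($) a) (($) b) (($) c)"

lemma det3_Const: "det3 (\<lambda>i. Const (a i)) (\<lambda>i. Const (b i)) (\<lambda>i. Const (c i)) = Const (det3 a b c)"
  by (simp add: det3_def Const_hom)

text \<open>Each factor depends on only one of the triples x, y, z, so every third-order derivative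
  in Omega splits into a product and the operator determinant becomes the determinant of the three
  gradients.\<close>

lemma Omega_prod:
  assumes "\<And>i. pd (Y i) P = 0" "\<And>i. pd (Z i) P = 0"
    and "\<And>i. pd (X i) Q = 0" "\<And>i. pd (Z i) Q = 0"
    and "\<And>i. pd (X i) R = 0" "\<And>i. pd (Y i) R = 0"
  shows "Omega (P * Q * R) = det3 (\<lambda>i. pd (X i) P) (\<lambda>i. pd (Y i) Q) (\<lambda>i. pd (Z i) R)"
proof -
  have "pd (X i) (pd (Y j) (pd (Z k) (P * Q * R))) = pd (X i) P * pd (Y j) Q * pd (Z k) R" for i j k
    using assms pd_commute[of "Y j" "Z k" R] pd_commute[of "X i" "Z k" R] pd_commute[of "X i" "Y j" Q]
    by (simp add: pd_mult)
  then show ?thesis by (simp add: Omega_def det3_def algebra_simps)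
qed

lemma pd_const_mult: "pd v K = 0 \<Longrightarrow> pd v (K * F) = K * pd v F"
  by (simp add: pd_mult)

lemma Omega_const_mult:
  assumes "\<And>i. pd (X i) K = 0" "\<And>i. pd (Y i) K = 0" "\<And>i. pd (Z i) K = 0"
  shows "Omega (K * F) = K * Omega F"
  using assms by (simp add: Omega_def pd_const_mult) (simp add: algebra_simps)

lemma Omega_add: "Omega (F + G) = Omega F + Omega G"
  by (simp add: Omega_def pd_add)

text \<open>The triple of variables is a parameter: the same form is needed in x, y and z, and
  brackets containing u are linear forms in \<open>U\<close>.\<close>

definition lform :: "(3 \<Rightarrow> var) \<Rightarrow> complex ^ 3 \<Rightarrow> pol" where
  "lform V a = Const (a$1) * Var (V 1) + Const (a$2) * Var (V 2) + Const (a$3) * Var (V 3)"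

definition uform :: "(3 \<Rightarrow> var) \<Rightarrow> pol" where
  "uform V = Var (U 1) * Var (V 1) + Var (U 2) * Var (V 2) + Var (U 3) * Var (V 3)"

lemma lin_lform: "lin a = lform X a" and u_x_uform: "u_x = uform X"
  by (simp_all add: lin_def lform_def u_x_def uform_def)

lemma pd_lform: "inj V \<Longrightarrow> pd (V i) (lform V a) = Const (a$i)"
  using exhaust_3[of i] by (auto simp: lform_def pd_add pd_mult pd_Var inj_eq)

lemma pd_uform: "inj V \<Longrightarrow> (\<And>j. V i \<noteq> U j) \<Longrightarrow> pd (V i) (uform V) = Var (U i)"
  using exhaust_3[of i] by (auto simp: uform_def pd_add pd_mult pd_Var inj_eq)

lemma pd_lform_0: "(\<And>j. v \<noteq> V j) \<Longrightarrow> pd v (lform V a) = 0"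
  and pd_uform_0: "(\<And>j. v \<noteq> V j) \<Longrightarrow> (\<And>j. v \<noteq> U j) \<Longrightarrow> pd v (uform V) = 0"
  by (simp_all add: lform_def uform_def pd_add pd_mult pd_Var)

lemma inj_YZ [simp]: "inj Y" "inj Z"
  by (auto intro: injI)

text \<open>The symbolic products a_x^i u_x^e b_y^j u_y^f c_z^k u_z^g. Omega maps such a product to
  a combination of such products, with brackets as coefficients.\<close>

definition symbol :: "complex ^ 3 \<Rightarrow> complex ^ 3 \<Rightarrow> complex ^ 3 \<Rightarrow>
    nat \<Rightarrow> nat \<Rightarrow> nat \<Rightarrow> nat \<Rightarrow> nat \<Rightarrow> nat \<Rightarrow> pol" where
  "symbol a b c i e j f k g =
     (lform X a ^ i * uform X ^ e) * (lform Y b ^ j * uform Y ^ f) * (lform Z c ^ k * uform Z ^ g)"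

definition cross :: "complex ^ 3 \<Rightarrow> complex ^ 3 \<Rightarrow> complex ^ 3" where
  "cross a b = vector [a$2 * b$3 - a$3 * b$2, a$3 * b$1 - a$1 * b$3, a$1 * b$2 - a$2 * b$1]"

lemma det3_u:
  shows "det3 (\<lambda>i. Var (U i)) (\<lambda>i. Const (b$i)) (\<lambda>i. Const (c$i)) = lform U (cross b c)"
    and "det3 (\<lambda>i. Const (a$i)) (\<lambda>i. Var (U i)) (\<lambda>i. Const (c$i)) = lform U (cross c a)"
    and "det3 (\<lambda>i. Const (a$i)) (\<lambda>i. Const (b$i)) (\<lambda>i. Var (U i)) = lform U (cross a b)"
  by (simp_all add: det3_def lform_def cross_def Const_hom algebra_simps)

text \<open>All three rows involve the same vector u. Of the eight terms of the multilinear
  expansion, those with u in two rows vanish.\<close>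

lemma det3_expand:
  "det3 (\<lambda>l. p * a l + q * u l) (\<lambda>l. r * b l + s * u l) (\<lambda>l. t * c l + w * u l) =
     p * r * t * det3 a b c + q * r * t * det3 u b c + p * s * t * det3 a u c + p * r * w * det3 a b u"
  by (simp add: det3_def algebra_simps)

text \<open>The four terms carry the brackets [abc], [ubc], [auc] and [abu]. An exponent 0 causes no
  trouble with the truncated subtraction, since its factor in the coefficient is 0.\<close>

lemma Omega_symbol:
  "Omega (symbol a b c i e j f k g) =
     of_nat (i * j * k) * Const (bracket a b c) * symbol a b c (i-1) e (j-1) f (k-1) g
   + of_nat (e * j * k) * lform U (cross b c) * symbol a b c i (e-1) (j-1) f (k-1) g
   + of_nat (i * f * k) * lform U (cross c a) * symbol a b c (i-1) e j (f-1) (k-1) g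
   + of_nat (i * j * g) * lform U (cross a b) * symbol a b c (i-1) e (j-1) f k (g-1)"
proof -
  \<comment> \<open>The gradient of a factor is a combination of its coefficient vector and u, as
    \<open>det3_expand\<close> requires.\<close>
  have pw: "pd (V l) (lform V a ^ i * uform V ^ e) =
      (of_nat i * lform V a ^ (i-1) * uform V ^ e) * Const (a$l)
      + (of_nat e * lform V a ^ i * uform V ^ (e-1)) * Var (U l)"
    if "inj V" "\<And>i j. V i \<noteq> U j" for V l a i e
    using that by (simp add: pd_mult pd_power pd_lform pd_uform algebra_simps)
  have "Omega (symbol a b c i e j f k g) =
     det3 (\<lambda>l. pd (X l) (lform X a ^ i * uform X ^ e)) (\<lambda>l. pd (Y l) (lform Y b ^ j * uform Y ^ f))
       (\<lambda>l. pd (Z l) (lform Z c ^ k * uform Z ^ g))"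
    unfolding symbol_def by (rule Omega_prod) (simp_all add: pd_mult pd_power pd_lform_0 pd_uform_0)
  also have "\<dots> =
     (of_nat i * lform X a ^ (i-1) * uform X ^ e) * (of_nat j * lform Y b ^ (j-1) * uform Y ^ f) *
       (of_nat k * lform Z c ^ (k-1) * uform Z ^ g) * Const (bracket a b c)
   + (of_nat e * lform X a ^ i * uform X ^ (e-1)) * (of_nat j * lform Y b ^ (j-1) * uform Y ^ f) *
       (of_nat k * lform Z c ^ (k-1) * uform Z ^ g) * lform U (cross b c)
   + (of_nat i * lform X a ^ (i-1) * uform X ^ e) * (of_nat f * lform Y b ^ j * uform Y ^ (f-1)) *
       (of_nat k * lform Z c ^ (k-1) * uform Z ^ g) * lform U (cross c a)
   + (of_nat i * lform X a ^ (i-1) * uform X ^ e) * (of_nat j * lform Y b ^ (j-1) * uform Y ^ f) *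
       (of_nat g * lform Z c ^ k * uform Z ^ (g-1)) * lform U (cross a b)"
    by (simp add: pw det3_expand det3_u det3_Const del: of_nat_mult)
  also have "\<dots> = of_nat (i * j * k) * Const (bracket a b c) * symbol a b c (i-1) e (j-1) f (k-1) g
   + of_nat (e * j * k) * lform U (cross b c) * symbol a b c i (e-1) (j-1) f (k-1) g
   + of_nat (i * f * k) * lform U (cross c a) * symbol a b c (i-1) e j (f-1) (k-1) g
   + of_nat (i * j * g) * lform U (cross a b) * symbol a b c (i-1) e (j-1) f k (g-1)"
    by (simp add: symbol_def mult_ac)
  finally show ?thesis .
qed

lemma pd_numeral [simp]: "pd v (numeral n) = 0"
  using pd_Const[of v "numeral n"] by (simp del: pd_Const)

text \<open>Each Omega lowers the degree in every triple by one and differentiates at most one of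
  u_x, u_y, u_z. Hence three of the four steps use up these factors and one gives [abc]. There are
  4! orders, each with the factor (3!)^3 from the cubes, and 24 * 216 = 5184.\<close>

lemma Omega4_symbol:
  "(Omega ^^ 4) (symbol a b c 3 1 3 1 3 1) =
     5184 * (Const (bracket a b c) * lform U (cross b c) * lform U (cross c a) * lform U (cross a b))"
proof -
  have funpow: "(Omega ^^ 4) F = Omega (Omega (Omega (Omega F)))" for F
    by (simp add: numeral_eq_Suc)
  have s0: "symbol a b c 0 0 0 0 0 0 = 1" by (simp add: symbol_def)
  show ?thesis
    unfolding funpow
    by (simp add: Omega_symbol Omega_const_mult Omega_add pd_mult pd_lform_0 s0
        distrib_left mult.assoc[symmetric])
qed


lemma psubst_to_Y: "psubst to_Y (lin b ^ 3 * u_x) = lform Y b ^ 3 * uform Y"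
  and psubst_to_Z: "psubst to_Z (lin b ^ 3 * u_x) = lform Z b ^ 3 * uform Z"
  by (simp_all add: lin_def lform_def u_x_def uform_def psubst_add psubst_mult psubst_power)

lemma psubst_to_X_lform_U: "psubst to_X (lform U b) = lform U b"
  by (simp add: lform_def psubst_add psubst_mult)

lemma transvectant_cubes:
  "transvectant 4 (lin a ^ 3 * u_x) (lin b ^ 3 * u_x) (lin c ^ 3 * u_x) =
     Const (5184 * bracket a b c) * lform U (cross b c) * lform U (cross c a) * lform U (cross a b)"
proof -
  have "lin a ^ 3 * u_x * psubst to_Y (lin b ^ 3 * u_x) * psubst to_Z (lin c ^ 3 * u_x)
      = symbol a b c 3 1 3 1 3 1"
    unfolding psubst_to_Y psubst_to_Z by (simp add: symbol_def lin_lform u_x_uform)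
  then have "transvectant 4 (lin a ^ 3 * u_x) (lin b ^ 3 * u_x) (lin c ^ 3 * u_x) =
    psubst to_X (Const 5184 * (Const (bracket a b c) * lform U (cross b c) * lform U (cross c a) * lform U (cross a b)))"
    by (simp only: transvectant_def Omega4_symbol Const_numeral)
  then show ?thesis
    by (simp only: psubst_mult psubst_Const psubst_to_X_lform_U Const_mult mult.assoc)
qed

section \<open>Polarisation of the Aronhold invariant\<close>

lemma transvectant_add:
  "transvectant n (f + f') g h = transvectant n f g h + transvectant n f' g h"
  "transvectant n f (g + g') h = transvectant n f g h + transvectant n f g' h"
  "transvectant n f g (h + h') = transvectant n f g h + transvectant n f g h'"
proof -
  have "(Omega ^^ n) (F + G) = (Omega ^^ n) F + (Omega ^^ n) G" for F G
    by (induction n) (simp_all add: Omega_add)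
  then show "transvectant n (f + f') g h = transvectant n f g h + transvectant n f' g h"
    "transvectant n f (g + g') h = transvectant n f g h + transvectant n f g' h"
    "transvectant n f g (h + h') = transvectant n f g h + transvectant n f g h'"
    by (simp_all add: transvectant_def psubst_add algebra_simps)
qed

lemma subst_u3_add:
  "subst_u3 (f + g) \<phi> = subst_u3 f \<phi> + subst_u3 g \<phi>"
  "subst_u3 f (\<phi> + \<psi>) = subst_u3 f \<phi> + subst_u3 f \<psi>"
  by (simp_all add: subst_u3_def split_def lookup_add distrib_left distrib_right add_divide_distrib sum.distrib)

text \<open>The trivial exponents are written out so that each summand has the shape of
  \<open>lookup_monomial\<close>.\<close>

lemma lform_mult3:
  "Const k * lform V p * lform V q * lform V r =
     Const (k * p$1 * q$1 * r$1) * Var (V 1) ^ 3 * Var (V 2) ^ 0 * Var (V 3) ^ 0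
   + Const (k * p$2 * q$2 * r$2) * Var (V 1) ^ 0 * Var (V 2) ^ 3 * Var (V 3) ^ 0
   + Const (k * p$3 * q$3 * r$3) * Var (V 1) ^ 0 * Var (V 2) ^ 0 * Var (V 3) ^ 3
   + Const (k * (p$1 * q$1 * r$2 + p$1 * q$2 * r$1 + p$2 * q$1 * r$1)) * Var (V 1) ^ 2 * Var (V 2) ^ 1 * Var (V 3) ^ 0
   + Const (k * (p$1 * q$1 * r$3 + p$1 * q$3 * r$1 + p$3 * q$1 * r$1)) * Var (V 1) ^ 2 * Var (V 2) ^ 0 * Var (V 3) ^ 1
   + Const (k * (p$2 * q$2 * r$1 + p$2 * q$1 * r$2 + p$1 * q$2 * r$2)) * Var (V 1) ^ 1 * Var (V 2) ^ 2 * Var (V 3) ^ 0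
   + Const (k * (p$2 * q$2 * r$3 + p$2 * q$3 * r$2 + p$3 * q$2 * r$2)) * Var (V 1) ^ 0 * Var (V 2) ^ 2 * Var (V 3) ^ 1
   + Const (k * (p$3 * q$3 * r$1 + p$3 * q$1 * r$3 + p$1 * q$3 * r$3)) * Var (V 1) ^ 1 * Var (V 2) ^ 0 * Var (V 3) ^ 2
   + Const (k * (p$3 * q$3 * r$2 + p$3 * q$2 * r$3 + p$2 * q$3 * r$3)) * Var (V 1) ^ 0 * Var (V 2) ^ 1 * Var (V 3) ^ 2
   + Const (k * (p$1 * q$2 * r$3 + p$1 * q$3 * r$2 + p$2 * q$1 * r$3 + p$2 * q$3 * r$1 + p$3 * q$1 * r$2 + p$3 * q$2 * r$1))
       * Var (V 1) ^ 1 * Var (V 2) ^ 1 * Var (V 3) ^ 1"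
  unfolding lform_def Const_add Const_mult
  by (simp add: power2_eq_square power3_eq_cube algebra_simps)

text \<open>The multinomial coefficients of d_x^3 cancel the factorials in \<open>subst_u3\<close>,
  so substituting a cube amounts to evaluation at u = d.\<close>

lemma subst_u3_lin_cube:
  "subst_u3 (lin d ^ 3) (Const k * lform U p * lform U q * lform U r) =
     k * (d$1 * p$1 + d$2 * p$2 + d$3 * p$3) * (d$1 * q$1 + d$2 * q$2 + d$3 * q$3)
       * (d$1 * r$1 + d$2 * r$2 + d$3 * r$3)"
proof -
  have "lin d ^ 3 = Const 1 * lform X d * lform X d * lform X d"
    by (simp add: lin_lform power3_eq_cube)
  then show ?thesis
    unfolding subst_u3_def triples_3
    by (simp only: lform_mult3 lookup_add lookup_monomial[OF inj_XU(1)] lookup_monomial[OF inj_XU(2)])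
      (simp add: fact_numeral, simp add: field_simps)
qed

definition aronhold_polar :: "pol \<Rightarrow> pol \<Rightarrow> pol \<Rightarrow> pol \<Rightarrow> complex" where
  "aronhold_polar f g h k =
     subst_u3 k (Const (1 / 576) * transvectant 4 (f * u_x) (g * u_x) (h * u_x))"

lemma aronhold_S_polar: "aronhold_S f = aronhold_polar f f f f"
  by (simp add: aronhold_S_def S_uuu_def aronhold_polar_def)

lemma aronhold_polar_add:
  "aronhold_polar (f + f') g h k = aronhold_polar f g h k + aronhold_polar f' g h k"
  "aronhold_polar f (g + g') h k = aronhold_polar f g h k + aronhold_polar f g' h k"
  "aronhold_polar f g (h + h') k = aronhold_polar f g h k + aronhold_polar f g h' k"
  "aronhold_polar f g h (k + k') = aronhold_polar f g h k + aronhold_polar f g h k'"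
  by (simp_all add: aronhold_polar_def distrib_left distrib_right transvectant_add subst_u3_add)

text \<open>The constant is 5184 / 576 = 9, and evaluation at u = d turns [ubc], [auc], [abu] into
  [dbc], [adc], [abd].\<close>

lemma aronhold_polar_cubes:
  "aronhold_polar (lin a ^ 3) (lin b ^ 3) (lin c ^ 3) (lin d ^ 3) =
     9 * (bracket a b c * bracket d b c * bracket a d c * bracket a b d)"
proof -
  have "Const (1 / 576) * transvectant 4 (lin a ^ 3 * u_x) (lin b ^ 3 * u_x) (lin c ^ 3 * u_x) =
     Const (9 * bracket a b c) * lform U (cross b c) * lform U (cross c a) * lform U (cross a b)"
    unfolding transvectant_cubes mult.assoc[symmetric] Const_mult[symmetric] by simp
  moreover have
    "d$1 * cross b c$1 + d$2 * cross b c$2 + d$3 * cross b c$3 = bracket d b c"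
    "d$1 * cross c a$1 + d$2 * cross c a$2 + d$3 * cross c a$3 = bracket a d c"
    "d$1 * cross a b$1 + d$2 * cross a b$2 + d$3 * cross a b$3 = bracket a b d"
    by (simp_all add: det3_def cross_def algebra_simps)
  ultimately show ?thesis
    by (simp add: aronhold_polar_def subst_u3_lin_cube)
qed

section \<open>Degenerate cubics\<close>


lemma det3_same [simp]: "det3 a a c = 0" "det3 a b a = 0" "det3 a b b = 0"
  by (simp_all add: det3_def algebra_simps)

lemma det3_swap: "det3 a c b = - det3 a b c"
  by (simp add: det3_def algebra_simps)

text \<open>A term with a repeated cube contains a vanishing bracket, so only the 24 arrangements of
  a, b, c, d survive. They contribute equally, and 24 * 9 = 216; the sign comes from [adc] =
  -[acd].\<close>

lemma aronhold_S_four_cubes: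
  "aronhold_S (lin a ^ 3 + lin b ^ 3 + lin c ^ 3 + lin d ^ 3) =
     - 216 * (bracket a b c * bracket a b d * bracket a c d * bracket b c d)"
proof -
  \<comment> \<open>These rules sort the entries of a bracket. They are applied only at four fixed
    triples, because in general form they would loop.\<close>
  have *: "bracket x z y = - bracket x y z" "bracket y x z = - bracket x y z"
    "bracket y z x = bracket x y z" "bracket z x y = bracket x y z" "bracket z y x = - bracket x y z"
    for x y z by (simp_all add: det3_def algebra_simps)
  show ?thesis
    unfolding aronhold_S_polar
    by (simp add: aronhold_polar_add aronhold_polar_cubes
        *[where x = a and y = b and z = c] *[where x = a and y = b and z = d]
        *[where x = a and y = c and z = d]
        *[where x = b and y = c and z = d])
qed

section \<open>Sums of cubes on which the invariant vanishes\<close>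

lemma lin_add: "lin (a + b) = lin a + lin b"
  and lin_diff: "lin (a - b) = lin a - lin b"
  and lin_scale: "lin (k *s a) = Const k * lin a"
  by (simp_all add: lin_def Const_hom algebra_simps)

lemma Const_eq_0_iff [simp]: "Const c = 0 \<longleftrightarrow> c = 0"
  by (metis Const_def Const_0 lookup_single_eq)

lemma lin_eq_0_iff: "lin a = 0 \<longleftrightarrow> a = 0"
proof
  assume "lin a = 0"
  then have "pd (X i) (lin a) = 0" for i by simp
  then have "Const (a$i) = 0" for i by (simp add: lin_lform pd_lform)
  then show "a = 0" by (simp add: vec_eq_iff)
qed (simp add: lin_def)

lemma cube_root_exists: "\<exists>r::complex. r ^ 3 = w"
  using nth_root_exists[of 3 w] by auto

lemma Const_mult_lin_cube: "\<exists>k. Const w * lin v ^ 3 = lin (k *s v) ^ 3"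
proof -
  obtain k where "k ^ 3 = w" using cube_root_exists by blast
  then show ?thesis by (intro exI[of _ k]) (auto simp: lin_scale power_mult_distrib Const_hom)
qed

text \<open>The polar is computed only on cubes; induction over this predicate extends identities
  that are additive in an argument. Scalar multiples of cubes are covered because complex numbers
  have cube roots.\<close>

inductive cube_sum :: "pol \<Rightarrow> bool" where
  cube: "cube_sum (lin a ^ 3)"
| add: "cube_sum f \<Longrightarrow> cube_sum g \<Longrightarrow> cube_sum (f + g)"

lemma cube_sum_Const_mult: "cube_sum (Const w * lin v ^ 3)"
  using Const_mult_lin_cube[of w v] cube_sum.cube by metis

text \<open>This is (z + x)^3 - (z - x)^3 = 6 x z^2 + 2 x^3, solved for x z^2.\<close>

lemma mult_square_cubes:
  "lin x * lin z ^ 2 = Const (1/6) * lin (z + x) ^ 3 + Const (- 1/6) * lin (z - x) ^ 3 + Const (- 1/3) * lin x ^ 3"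
proof -
  \<comment> \<open>The fractions are constant polynomials that ring normalisation does not combine,
    so both sides are compared after multiplication by 6.\<close>
  have "6 * (Const (1/6) * p + Const (- 1/6) * q + Const (- 1/3) * r) = p - q - 2 * r" for p q r
  proof -
    have "6 * (Const (1/6) * p + Const (- 1/6) * q + Const (- 1/3) * r)
      = Const (6 * (1/6)) * p + Const (6 * (- 1/6)) * q + Const (6 * (- 1/3)) * r"
      unfolding Const_mult by (simp add: algebra_simps)
    then show ?thesis by (simp add: Const_minus)
  qed
  then have "6 * (Const (1/6) * lin (z + x) ^ 3 + Const (- 1/6) * lin (z - x) ^ 3 + Const (- 1/3) * lin x ^ 3)
     = lin (z + x) ^ 3 - lin (z - x) ^ 3 - 2 * lin x ^ 3" .
  also have "\<dots> = 6 * (lin x * lin z ^ 2)"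
    by (simp add: lin_add lin_diff power3_eq_cube power2_eq_square algebra_simps)
  finally have "6 * (Const (1/6) * lin (z + x) ^ 3 + Const (- 1/6) * lin (z - x) ^ 3 + Const (- 1/3) * lin x ^ 3)
     = 6 * (lin x * lin z ^ 2)" .
  moreover have "p = q" if "6 * p = 6 * q" for p q :: pol
  proof -
    have "Const (1/6 * 6) * p = Const (1/6 * 6) * q"
      unfolding Const_mult using that by (simp add: mult.assoc)
    then show ?thesis by simp
  qed
  ultimately show ?thesis by metis
qed

lemma aronhold_polar_0: "aronhold_polar f g h 0 = 0" "aronhold_polar 0 f g h = 0"
  "aronhold_polar f 0 g h = 0" "aronhold_polar f g 0 h = 0"
  using aronhold_polar_add(1)[of 0 0 f g h] aronhold_polar_add(2)[of f 0 0 g h]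
    aronhold_polar_add(3)[of f g 0 0 h] aronhold_polar_add(4)[of f g h 0 0]
  by simp_all

lemma aronhold_polar_minus:
  "aronhold_polar (- f) g h k = - aronhold_polar f g h k"
  "aronhold_polar f (- g) h k = - aronhold_polar f g h k"
  "aronhold_polar f g (- h) k = - aronhold_polar f g h k"
  "aronhold_polar f g h (- k) = - aronhold_polar f g h k"
  using aronhold_polar_add(1)[of f "- f" g h k] aronhold_polar_add(2)[of f g "- g" h k]
    aronhold_polar_add(3)[of f g h "- h" k] aronhold_polar_add(4)[of f g h k "- k"]
  by (simp_all add: aronhold_polar_0 eq_neg_iff_add_eq_0 add.commute)

text \<open>On cubes, two equal arguments make one of the four brackets vanish; additivity in the
  other two arguments does the rest.\<close>

lemma aronhold_polar_repeated_cube: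
  assumes "cube_sum f" "cube_sum g"
  shows "aronhold_polar (lin d ^ 3) (lin d ^ 3) f g = 0" "aronhold_polar (lin d ^ 3) f (lin d ^ 3) g = 0"
    "aronhold_polar (lin d ^ 3) f g (lin d ^ 3) = 0" "aronhold_polar f (lin d ^ 3) (lin d ^ 3) g = 0"
    "aronhold_polar f (lin d ^ 3) g (lin d ^ 3) = 0" "aronhold_polar f g (lin d ^ 3) (lin d ^ 3) = 0"
proof -
  have "\<forall>h\<in>{aronhold_polar (lin d ^ 3) (lin d ^ 3) f g, aronhold_polar (lin d ^ 3) f (lin d ^ 3) g,
    aronhold_polar (lin d ^ 3) f g (lin d ^ 3), aronhold_polar f (lin d ^ 3) (lin d ^ 3) g,
    aronhold_polar f (lin d ^ 3) g (lin d ^ 3), aronhold_polar f g (lin d ^ 3) (lin d ^ 3)}. h = 0"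
    using assms(1)
  proof induction
    case (cube a)
    from assms(2) show ?case
      by induction (simp_all add: aronhold_polar_cubes aronhold_polar_add)
  qed (simp add: aronhold_polar_add)
  then show "aronhold_polar (lin d ^ 3) (lin d ^ 3) f g = 0" "aronhold_polar (lin d ^ 3) f (lin d ^ 3) g = 0"
    "aronhold_polar (lin d ^ 3) f g (lin d ^ 3) = 0" "aronhold_polar f (lin d ^ 3) (lin d ^ 3) g = 0"
    "aronhold_polar f (lin d ^ 3) g (lin d ^ 3) = 0" "aronhold_polar f g (lin d ^ 3) (lin d ^ 3) = 0"
    by simp_all
qed

text \<open>Terms of S(f + t d^3) with d^3 in two or more places vanish, so S is affine in t. Stated
  here is the midpoint property for t = 1 and t = -1.\<close>

lemma aronhold_S_add_cube:
  assumes "cube_sum f"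
  shows "aronhold_S (f + lin d ^ 3) + aronhold_S (f - lin d ^ 3) = 2 * aronhold_S f"
proof -
  have e: "f - lin d ^ 3 = f + - (lin d ^ 3)" by simp
  show ?thesis
    unfolding aronhold_S_polar e aronhold_polar_add aronhold_polar_minus
    by (simp add: aronhold_polar_repeated_cube assms cube_sum.cube)
qed

text \<open>The product x z^2 is a sum of three cubes of forms in the span of x and z, which are
  dependent, so one of the four brackets is 0.\<close>

lemma aronhold_S_cuspidal:
  "aronhold_S (lin x * lin z ^ 2 + Const A * lin y ^ 3) = 0"
proof -
  obtain k1 k2 k3 k4 where
    "Const (1/6) * lin (z + x) ^ 3 = lin (k1 *s (z + x)) ^ 3"
    "Const (- 1/6) * lin (z - x) ^ 3 = lin (k2 *s (z - x)) ^ 3"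
    "Const (- 1/3) * lin x ^ 3 = lin (k3 *s x) ^ 3"
    "Const A * lin y ^ 3 = lin (k4 *s y) ^ 3"
    using Const_mult_lin_cube by metis
  moreover have "bracket (k1 *s (z + x)) (k2 *s (z - x)) (k3 *s x) = 0"
    by (simp add: det3_def algebra_simps)
  ultimately show ?thesis
    unfolding mult_square_cubes by (simp add: aronhold_S_four_cubes)
qed

lemma aronhold_S_cuspidal':
  assumes "A \<noteq> 0"
  shows "aronhold_S (lin x * lin z ^ 2 + Const A * lin y ^ 3 + Const B * lin y ^ 2 * lin z) = 0"
proof -
  \<comment> \<open>Completing the cube: A (y + k z)^3 absorbs the y^2 z term, and what is left over
    is a linear form times z^2.\<close>
  define k where "k = B / (3 * A)"
  have B: "B = 3 * A * k" using assms by (simp add: k_def)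
  have "lin x * lin z ^ 2 + Const A * lin y ^ 3 + Const B * lin y ^ 2 * lin z =
    lin (x - (3 * A * k^2) *s y - (A * k^3) *s z) * lin z ^ 2 + Const A * lin (y + k *s z) ^ 3"
    unfolding B
    by (simp add: lin_add lin_diff lin_scale Const_hom power3_eq_cube power2_eq_square algebra_simps)
  then show ?thesis by (simp only: aronhold_S_cuspidal)
qed

lemma aronhold_S_degenerate:
  "aronhold_S (lin x * lin z ^ 2 + Const A * lin y ^ 3 + Const B * lin y ^ 2 * lin z) = 0"
proof (cases "A = 0")
  case True
  \<comment> \<open>Adding and subtracting y^3 leads to the cases A = 1 and A = -1, and S of this
    form is the mean of the two values.\<close>
  let ?f = "lin x * lin z ^ 2 + lin (B *s z) * lin y ^ 2"
  have "cube_sum ?f"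
    unfolding mult_square_cubes by (intro cube_sum.add cube_sum_Const_mult)
  then have "2 * aronhold_S ?f = aronhold_S (?f + lin y ^ 3) + aronhold_S (?f - lin y ^ 3)"
    by (simp add: aronhold_S_add_cube)
  moreover have "aronhold_S (?f + lin y ^ 3) = 0" "aronhold_S (?f - lin y ^ 3) = 0"
    using aronhold_S_cuspidal'[of 1 x z y B] aronhold_S_cuspidal'[of "- 1" x z y B]
    by (simp_all add: lin_scale Const_minus algebra_simps)
  ultimately show ?thesis using True by (simp add: lin_scale mult_ac)
qed (rule aronhold_S_cuspidal')

section \<open>Decomposition into four cubes\<close>


text \<open>The equations say A x^3 + 3 B x^2 z + 3 C x z^2 + t z^3 = (p x + m z)^3 + (q x + n z)^3.
  The coefficient t is left free, so that finitely many bad values can be avoided later.\<close>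

lemma binary_cubic_two_cubes:
  fixes A B C :: complex
  assumes "A \<noteq> 0 \<or> B \<noteq> 0"
  shows "\<exists>N. finite N \<and> (\<forall>t. t \<notin> N \<longrightarrow> (\<exists>p m q n. A = p ^ 3 + q ^ 3 \<and> B = p ^ 2 * m + q ^ 2 * n \<and>
      C = p * m ^ 2 + q * n ^ 2 \<and> t = m ^ 3 + n ^ 3))"
proof (cases "A = 0")
  case True
  then have "B \<noteq> 0" using assms by simp
  \<comment> \<open>With X = x + k z the cubic becomes 3 B X^2 z + (t - 3 B k^2) z^3, which is to
    equal p^3 ((X + m0 z)^3 - (X - m0 z)^3).\<close>
  define k where "k = C / (2 * B)"
  have C: "C = 2 * B * k" using \<open>B \<noteq> 0\<close> by (simp add: k_def)
  have "\<exists>p m q n. A = p ^ 3 + q ^ 3 \<and> B = p ^ 2 * m + q ^ 2 * n \<and>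
      C = p * m ^ 2 + q * n ^ 2 \<and> t = m ^ 3 + n ^ 3" if t: "t \<noteq> 3 * B * k ^ 2" for t
  proof -
    define m0 where "m0 = csqrt ((t - 3 * B * k ^ 2) / B)"
    have m0: "B * m0 ^ 2 = t - 3 * B * k ^ 2" "m0 \<noteq> 0"
      using t \<open>B \<noteq> 0\<close> by (auto simp: m0_def)
    obtain p where p: "p ^ 3 = B / (2 * m0)" using cube_root_exists by blast
    then have B: "B = 2 * p ^ 3 * m0" using m0(2) by simp
    have t': "t = B * m0 ^ 2 + 3 * B * k ^ 2" using m0(1) by simp
    show ?thesis
      by (rule exI[of _ p], rule exI[of _ "p * (k + m0)"], rule exI[of _ "- p"], rule exI[of _ "- p * (k - m0)"])
        (simp add: True t' C B power2_eq_square power3_eq_cube algebra_simps)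
  qed
  then show ?thesis by (intro exI[of _ "{3 * B * k ^ 2}"]) auto
next
  case False
  \<comment> \<open>With X = x + k z the x^2 z term disappears: the cubic becomes A X^3 + 3 C1 X z^2
    + t1 z^3, where t1 = t - 3 C1 k - A k^3.\<close>
  define k where "k = B / A"
  define C1 where "C1 = C - A * k ^ 2"
  have B: "B = A * k" and C: "C = C1 + A * k ^ 2" using False by (simp_all add: k_def C1_def)
  show ?thesis
  proof (cases "C1 = 0")
    case True
    have "\<exists>p m q n. A = p ^ 3 + q ^ 3 \<and> B = p ^ 2 * m + q ^ 2 * n \<and>
      C = p * m ^ 2 + q * n ^ 2 \<and> t = m ^ 3 + n ^ 3" for t
    proof -
      obtain p where p: "p ^ 3 = A" using cube_root_exists by blast
      obtain n where n: "n ^ 3 = t - A * k ^ 3" using cube_root_exists by blast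
      have t': "t = n ^ 3 + A * k ^ 3" using n by simp
      show ?thesis
        by (rule exI[of _ p], rule exI[of _ "p * k"], rule exI[of _ 0], rule exI[of _ n])
          (simp add: t' B C True p[symmetric] power2_eq_square power3_eq_cube algebra_simps)
    qed
    then show ?thesis by (intro exI[of _ "{}"]) auto
  next
    case C1: False
    define c where "c = 3 * C1 * k + A * k ^ 3"
    \<comment> \<open>The excluded values are those with A t1^2 + 4 C1^3 = 0, where the discriminant
      of the reduced cubic vanishes.\<close>
    define r where "r = csqrt (- 4 * C1 ^ 3 / A)"
    have r2: "r ^ 2 = - 4 * C1 ^ 3 / A" by (simp add: r_def)
    have "\<exists>p m q n. A = p ^ 3 + q ^ 3 \<and> B = p ^ 2 * m + q ^ 2 * n \<and>
      C = p * m ^ 2 + q * n ^ 2 \<and> t = m ^ 3 + n ^ 3" if t: "t \<notin> {c + r, c - r}" for t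
    proof -
      define t1 where "t1 = t - c"
      have "t1 \<noteq> r" "t1 \<noteq> - r" using t by (auto simp: t1_def algebra_simps)
      then have "t1 ^ 2 \<noteq> r ^ 2" by (simp add: power2_eq_iff)
      then have ne: "t1 ^ 2 \<noteq> - 4 * C1 ^ 3 / A" by (simp add: r2)
      \<comment> \<open>The ansatz is \<alpha> (X - \<beta> s z)^3 + \<beta> (X + \<alpha> s z)^3,
        which has no X^2 z term. Comparing coefficients gives \<alpha> + \<beta> = A, C1 = A
        \<alpha> \<beta> s^2 and t1 = C1 s (\<alpha> - \<beta>); eliminating \<alpha> and \<beta>
        determines s^2.\<close>
      define s where "s = csqrt ((t1 ^ 2 / C1 ^ 2 + 4 * C1 / A) / A ^ 2)"
      have s2: "s ^ 2 = (t1 ^ 2 / C1 ^ 2 + 4 * C1 / A) / A ^ 2" by (simp add: s_def)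
      have "s \<noteq> 0"
      proof
        assume "s = 0"
        then have "t1 ^ 2 / C1 ^ 2 + 4 * C1 / A = 0" using s2 False by simp
        then have "t1 ^ 2 = - (4 * C1 / A) * C1 ^ 2" using C1
          by (simp add: divide_eq_eq eq_neg_iff_add_eq_0[symmetric])
        then show False using ne by (simp add: power2_eq_square power3_eq_cube)
      qed
      define \<alpha> where "\<alpha> = (A + t1 / (C1 * s)) / 2"
      define \<beta> where "\<beta> = (A - t1 / (C1 * s)) / 2"
      have sum: "A = \<alpha> + \<beta>" by (simp add: \<alpha>_def \<beta>_def field_simps)
      have "4 * (\<alpha> * \<beta> * s ^ 2) = A ^ 2 * s ^ 2 - t1 ^ 2 / C1 ^ 2"
        using \<open>s \<noteq> 0\<close> C1 unfolding \<alpha>_def \<beta>_def by (simp add: field_simps power2_eq_square)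
      also have "\<dots> = 4 * (C1 / A)" using False by (simp add: s2)
      finally have "\<alpha> * \<beta> * s ^ 2 = C1 / A" unfolding mult_cancel_left by simp
      then have prod: "C1 = A * \<alpha> * \<beta> * s ^ 2" using False by (simp add: field_simps)
      have "t1 = C1 * s * (\<alpha> - \<beta>)"
        using \<open>s \<noteq> 0\<close> C1 unfolding \<alpha>_def \<beta>_def by (simp add: field_simps)
      then have t': "t = C1 * s * (\<alpha> - \<beta>) + 3 * C1 * k + A * k ^ 3" by (simp add: t1_def c_def algebra_simps)
      obtain p where p: "\<alpha> = p ^ 3" using cube_root_exists by metis
      obtain q where q: "\<beta> = q ^ 3" using cube_root_exists by metis
      have 1: "A = p ^ 3 + q ^ 3" using sum p q by simp
      have 2: "B = p ^ 2 * (p * (k - \<beta> * s)) + q ^ 2 * (q * (k + \<alpha> * s))"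
      proof -
        have "p ^ 2 * (p * (k - \<beta> * s)) + q ^ 2 * (q * (k + \<alpha> * s)) = \<alpha> * (k - \<beta> * s) + \<beta> * (k + \<alpha> * s)"
          unfolding p q by (simp add: power2_eq_square power3_eq_cube mult_ac)
        then show ?thesis unfolding B sum by (simp add: algebra_simps)
      qed
      have 3: "C = p * (p * (k - \<beta> * s)) ^ 2 + q * (q * (k + \<alpha> * s)) ^ 2"
      proof -
        have "p * (p * (k - \<beta> * s)) ^ 2 + q * (q * (k + \<alpha> * s)) ^ 2 = \<alpha> * (k - \<beta> * s) ^ 2 + \<beta> * (k + \<alpha> * s) ^ 2"
          unfolding power_mult_distrib unfolding p q by (simp add: power2_eq_square power3_eq_cube mult_ac)
        then show ?thesis unfolding C prod unfolding sum by (simp add: power2_eq_square algebra_simps)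
      qed
      have 4: "t = (p * (k - \<beta> * s)) ^ 3 + (q * (k + \<alpha> * s)) ^ 3"
        unfolding power_mult_distrib p[symmetric] q[symmetric] t' prod unfolding sum
        by (simp add: power2_eq_square power3_eq_cube algebra_simps)
      from 1 2 3 4 show ?thesis by blast
    qed
    then show ?thesis by (intro exI[of _ "{c + r, c - r}"]) auto
  qed
qed

definition sum_of_four_cubes :: "pol \<Rightarrow> bool" where
  "sum_of_four_cubes f \<longleftrightarrow> (\<exists>a b c d. ternary_form 1 a \<and> ternary_form 1 b \<and> ternary_form 1 c \<and>
     ternary_form 1 d \<and> f = a ^ 3 + b ^ 3 + c ^ 3 + d ^ 3)"

lemma two_binary_cubics:
  assumes lin: "ternary_form 1 x" "ternary_form 1 y" "ternary_form 1 z"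
    and f: "f = Const A * x ^ 3 + 3 * Const B * x ^ 2 * z + 3 * Const C * x * z ^ 2
      + Const A' * y ^ 3 + 3 * Const B' * y ^ 2 * z + 3 * Const C' * y * z ^ 2 + Const D * z ^ 3"
  shows "sum_of_four_cubes f \<or> aronhold_S f = 0"
proof -
  obtain vx vy vz where v: "x = lin vx" "y = lin vy" "z = lin vz"
    using lin unfolding ternary_form_1_iff by blast
  consider "A = 0 \<and> B = 0" | "A' = 0 \<and> B' = 0" | "A \<noteq> 0 \<or> B \<noteq> 0" "A' \<noteq> 0 \<or> B' \<noteq> 0" by blast
  then show ?thesis
  proof cases
    case 1
    \<comment> \<open>Every remaining term in x is divisible by z^2; these are collected, with the
      z^3 term, into one linear form times z^2.\<close>
    have "f = lin ((3 * C) *s vx + (3 * C') *s vy + D *s vz) * lin vz ^ 2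
      + Const A' * lin vy ^ 3 + Const (3 * B') * lin vy ^ 2 * lin vz"
      unfolding f v by (simp add: 1 lin_add lin_scale Const_hom power2_eq_square power3_eq_cube algebra_simps)
    then show ?thesis by (simp add: aronhold_S_degenerate)
  next
    case 2
    have "f = lin ((3 * C) *s vx + (3 * C') *s vy + D *s vz) * lin vz ^ 2
      + Const A * lin vx ^ 3 + Const (3 * B) * lin vx ^ 2 * lin vz"
      unfolding f v by (simp add: 2 lin_add lin_scale Const_hom power2_eq_square power3_eq_cube algebra_simps)
    then show ?thesis by (simp add: aronhold_S_degenerate)
  next
    case 3
    obtain N where N: "finite N" "\<And>t. t \<notin> N \<Longrightarrow> (\<exists>p m q n. A = p ^ 3 + q ^ 3 \<and> B = p ^ 2 * m + q ^ 2 * n \<and>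
      C = p * m ^ 2 + q * n ^ 2 \<and> t = m ^ 3 + n ^ 3)"
      using binary_cubic_two_cubes[OF 3(1)] by metis
    obtain N' where N': "finite N'" "\<And>t. t \<notin> N' \<Longrightarrow> (\<exists>p m q n. A' = p ^ 3 + q ^ 3 \<and> B' = p ^ 2 * m + q ^ 2 * n \<and>
      C' = p * m ^ 2 + q * n ^ 2 \<and> t = m ^ 3 + n ^ 3)"
      using binary_cubic_two_cubes[OF 3(2)] by metis
    \<comment> \<open>The coefficient D of z^3 is split as t + (D - t) between the two binary
      cubics; each of them forbids finitely many t.\<close>
    have "finite (N \<union> (\<lambda>t. D - t) ` N')" using N(1) N'(1) by simp
    then obtain t where t: "t \<notin> N \<union> (\<lambda>t. D - t) ` N'"
      using ex_new_if_finite[OF infinite_UNIV_char_0[where 'a = complex]] by metis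
    then have "t \<notin> N" "D - t \<notin> N'" by (auto simp: image_iff)
    then obtain p m q n p' m' q' n' where
      e: "A = p ^ 3 + q ^ 3" "B = p ^ 2 * m + q ^ 2 * n" "C = p * m ^ 2 + q * n ^ 2" "t = m ^ 3 + n ^ 3"
      "A' = p' ^ 3 + q' ^ 3" "B' = p' ^ 2 * m' + q' ^ 2 * n'" "C' = p' * m' ^ 2 + q' * n' ^ 2" "D - t = m' ^ 3 + n' ^ 3"
      using N(2) N'(2) by metis
    have D: "D = m ^ 3 + n ^ 3 + (m' ^ 3 + n' ^ 3)" using e(4,8) by (simp add: algebra_simps)
    have "f = (Const p * x + Const m * z) ^ 3 + (Const q * x + Const n * z) ^ 3
       + (Const p' * y + Const m' * z) ^ 3 + (Const q' * y + Const n' * z) ^ 3"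
      unfolding f e(1-3,5-7) D Const_hom by (simp add: power2_eq_square power3_eq_cube algebra_simps)
    moreover have "ternary_form 1 (Const a * x + Const b * z)" "ternary_form 1 (Const a * y + Const b * z)" for a b
      using lin by (auto intro!: ternary_form_closed)
    ultimately show ?thesis unfolding sum_of_four_cubes_def by blast
  qed
qed

section \<open>Symmetric trilinear forms and coordinate changes\<close>

definition tri :: "(3 \<Rightarrow> 3 \<Rightarrow> 3 \<Rightarrow> 'a::comm_ring_1) \<Rightarrow> (3 \<Rightarrow> 'a) \<Rightarrow> (3 \<Rightarrow> 'a) \<Rightarrow> (3 \<Rightarrow> 'a) \<Rightarrow> 'a" where
  "tri T p q r = (\<Sum>i\<in>UNIV. \<Sum>j\<in>UNIV. \<Sum>k\<in>UNIV. T i j k * p i * q j * r k)"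

definition symmetric_tensor :: "(3 \<Rightarrow> 3 \<Rightarrow> 3 \<Rightarrow> 'a) \<Rightarrow> bool" where
  "symmetric_tensor T \<longleftrightarrow> (\<forall>i j k. T i j k = T j i k \<and> T i j k = T i k j)"

lemma tri_commute:
  assumes "symmetric_tensor T"
  shows "tri T p q r = tri T q p r" "tri T p q r = tri T p r q"
proof -
  have T: "T i j k = T j i k" "T i j k = T i k j" for i j k
    using assms unfolding symmetric_tensor_def by blast+
  show "tri T p q r = tri T q p r"
    unfolding tri_def by (subst sum.swap, subst T(1)) (simp add: mult_ac)
  show "tri T p q r = tri T p r q"
    unfolding tri_def by (rule sum.cong[OF refl], subst sum.swap, subst T(2)) (simp add: mult_ac)
qed

lemma tri_add:
  "tri T (\<lambda>i. p i + p' i) q r = tri T p q r + tri T p' q r"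
  "tri T p (\<lambda>i. q i + q' i) r = tri T p q r + tri T p q' r"
  "tri T p q (\<lambda>i. r i + r' i) = tri T p q r + tri T p q r'"
  by (simp_all add: tri_def distrib_left distrib_right sum.distrib)

lemma tri_scale:
  "tri T (\<lambda>i. c * p i) q r = c * tri T p q r"
  "tri T p (\<lambda>i. c * q i) r = c * tri T p q r"
  "tri T p q (\<lambda>i. c * r i) = c * tri T p q r"
  by (simp_all add: tri_def sum_distrib_left mult_ac)

lemma Const_sum: "Const (sum g A) = (\<Sum>i\<in>A. Const (g i))"
  by (induction A rule: infinite_finite_induct) (simp_all add: Const_add)

lemma tri_Const:
  "tri (\<lambda>i j k. Const (T i j k)) (\<lambda>i. Const (p i)) (\<lambda>i. Const (q i)) (\<lambda>i. Const (r i)) = Const (tri T p q r)"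
  by (simp add: tri_def Const_sum Const_mult)

text \<open>Cramer's rule without division, so that it also holds for rows of polynomials.\<close>

lemma det3_cramer:
  "det3 a b c * x i = det3 x b c * a i + det3 a x c * b i + det3 a b x * c i"
  using exhaust_3[of i] by (auto simp: det3_def algebra_simps)

lemma tri_eq_0_basis:
  fixes a b c :: "3 \<Rightarrow> complex"
  assumes "det3 a b c \<noteq> 0" "tri T x y a = 0" "tri T x y b = 0" "tri T x y c = 0"
  shows "tri T x y q = 0"
proof -
  have "det3 a b c * tri T x y q = tri T x y (\<lambda>i. det3 a b c * q i)" by (simp add: tri_scale)
  also have "(\<lambda>i. det3 a b c * q i) =
      (\<lambda>i. det3 q b c * a i + det3 a q c * b i + det3 a b q * c i)"
    by (rule ext) (rule det3_cramer)
  also have "tri T x y \<dots> = 0" using assms(2-4) by (simp add: tri_add tri_scale)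
  finally show ?thesis using assms(1) by simp
qed


text \<open>In coordinates \<xi>, \<eta>, \<zeta> for the basis p, v, w, the hypothesis F(p, v, -) =
  0 kills every monomial divisible by \<xi> \<eta>. What remains is a binary cubic in \<xi>, \<zeta>
  plus one in \<eta>, \<zeta>.\<close>

lemma tri_split_basis:
  fixes f :: pol and T :: "3 \<Rightarrow> 3 \<Rightarrow> 3 \<Rightarrow> complex"
  assumes T: "symmetric_tensor T" and x: "\<And>i. ternary_form 1 (x i)"
    and f: "f = tri (\<lambda>i j k. Const (T i j k)) x x x"
    and basis: "det3 p v w \<noteq> 0" and pv: "\<And>q. tri T p v q = 0"
  shows "sum_of_four_cubes f \<or> aronhold_S f = 0"
proof -
  define T' where "T' = (\<lambda>i j k. Const (T i j k))"
  define p' v' w' where "p' = (\<lambda>i. Const (p i))" and "v' = (\<lambda>i. Const (v i))" and "w' = (\<lambda>i. Const (w i))"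
  define d where "d = Const (1 / det3 p v w)"
  have d: "d * det3 p' v' w' = 1"
    unfolding d_def p'_def v'_def w'_def det3_Const Const_mult[symmetric] using basis by simp
  \<comment> \<open>By Cramer's rule these are the coordinates of the point x; they are linear forms
    because x enters each determinant once.\<close>
  define \<xi> \<eta> \<zeta> where "\<xi> = d * det3 x v' w'" and "\<eta> = d * det3 p' x w'" and "\<zeta> = d * det3 p' v' x"
  have form: "ternary_form 1 \<xi>" "ternary_form 1 \<eta>" "ternary_form 1 \<zeta>"
  proof -
    have c: "ternary_form 1 (g * Const c)" if "ternary_form 1 g" for g c
      using ternary_form_Const_mult[OF that, of c] by (simp add: mult.commute)
    show "ternary_form 1 \<xi>" "ternary_form 1 \<eta>" "ternary_form 1 \<zeta>"
      unfolding \<xi>_def \<eta>_def \<zeta>_def d_def p'_def v'_def w'_def det3_def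
      by (intro ternary_form_Const_mult ternary_form_add ternary_form_diff c x
          | simp only: Const_mult[symmetric] Const_diff[symmetric])+
  qed
  have x_eq: "x = (\<lambda>i. \<xi> * p' i + \<eta> * v' i + \<zeta> * w' i)"
  proof
    fix i
    have "x i = d * (det3 p' v' w' * x i)" using d by (simp add: mult.assoc[symmetric])
    also have "\<dots> = d * (det3 x v' w' * p' i + det3 p' x w' * v' i + det3 p' v' x * w' i)"
      by (subst det3_cramer) (rule refl)
    finally show "x i = \<xi> * p' i + \<eta> * v' i + \<zeta> * w' i"
      by (simp add: \<xi>_def \<eta>_def \<zeta>_def algebra_simps)
  qed
  have T'_sym: "symmetric_tensor T'"
    using T by (simp add: symmetric_tensor_def T'_def)
  note sym = tri_commute[OF T'_sym]
  have z: "tri T' p' v' p' = 0" "tri T' p' v' v' = 0" "tri T' p' v' w' = 0"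
    by (simp_all add: T'_def p'_def v'_def w'_def tri_Const pv)
  have c: "tri T' p' p' p' = Const (tri T p p p)" "tri T' p' p' w' = Const (tri T p p w)"
    "tri T' p' w' w' = Const (tri T p w w)" "tri T' v' v' v' = Const (tri T v v v)"
    "tri T' v' v' w' = Const (tri T v v w)" "tri T' v' w' w' = Const (tri T v w w)"
    "tri T' w' w' w' = Const (tri T w w w)"
    by (simp_all add: T'_def p'_def v'_def w'_def tri_Const)
  have perm: "tri T' p' p' v' = 0" "tri T' v' p' p' = 0"
    "tri T' v' p' v' = 0" "tri T' v' v' p' = 0"
    "tri T' v' p' w' = 0" "tri T' p' w' v' = 0" "tri T' v' w' p' = 0" "tri T' w' p' v' = 0" "tri T' w' v' p' = 0"
    "tri T' p' w' p' = tri T' p' p' w'" "tri T' w' p' p' = tri T' p' p' w'"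
    "tri T' w' p' w' = tri T' p' w' w'" "tri T' w' w' p' = tri T' p' w' w'"
    "tri T' v' w' v' = tri T' v' v' w'" "tri T' w' v' v' = tri T' v' v' w'"
    "tri T' w' v' w' = tri T' v' w' w'" "tri T' w' w' v' = tri T' v' w' w'"
    using z sym by metis+
  have "f = tri T' (\<lambda>i. \<xi> * p' i + \<eta> * v' i + \<zeta> * w' i) (\<lambda>i. \<xi> * p' i + \<eta> * v' i + \<zeta> * w' i)
      (\<lambda>i. \<xi> * p' i + \<eta> * v' i + \<zeta> * w' i)"
    unfolding f T'_def[symmetric] by (subst (1 2 3) x_eq) (rule refl)
  also have "\<dots> = Const (tri T p p p) * \<xi> ^ 3 + 3 * Const (tri T p p w) * \<xi> ^ 2 * \<zeta>
      + 3 * Const (tri T p w w) * \<xi> * \<zeta> ^ 2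
      + Const (tri T v v v) * \<eta> ^ 3 + 3 * Const (tri T v v w) * \<eta> ^ 2 * \<zeta>
      + 3 * Const (tri T v w w) * \<eta> * \<zeta> ^ 2 + Const (tri T w w w) * \<zeta> ^ 3"
    unfolding tri_add tri_scale z perm c
    by (simp add: power2_eq_square power3_eq_cube algebra_simps)
  finally show ?thesis using form by (rule two_binary_cubics[rotated 3])
qed

text \<open>Here p is a singular point of the cubic and lies in the kernel of the quadratic form
  F(p, -, -). A basis that diagonalises this form is adjusted along p to produce an independent pair
  as in \<open>tri_split_basis\<close>.\<close>

lemma tri_singular_point:
  fixes f :: pol and T :: "3 \<Rightarrow> 3 \<Rightarrow> 3 \<Rightarrow> complex"
  assumes T: "symmetric_tensor T" and x: "\<And>i. ternary_form 1 (x i)"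
    and f: "f = tri (\<lambda>i j k. Const (T i j k)) x x x"
    and basis: "det3 p v w \<noteq> 0" and pp: "\<And>q. tri T p p q = 0"
  shows "sum_of_four_cubes f \<or> aronhold_S f = 0"
proof -
  note sym = tri_commute[OF T]
  note split = tri_split_basis[OF T x f]
  obtain s s' where b: "det3 p s s' \<noteq> 0" and o: "tri T p s s' = 0"
  proof -
    \<comment> \<open>If v or w is not isotropic, the other vector is made orthogonal to it. If both
      are isotropic, v + w and v - w are orthogonal.\<close>
    consider "tri T p v v \<noteq> 0" | "tri T p w w \<noteq> 0" | "tri T p v v = 0" "tri T p w w = 0" by blast
    then show ?thesis
    proof cases
      case 1
      define k where "k = - tri T p v w / tri T p v v"
      have "det3 p v (\<lambda>i. w i + k * v i) = det3 p v w" by (simp add: det3_def algebra_simps)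
      moreover have "tri T p v (\<lambda>i. w i + k * v i) = 0" unfolding tri_add tri_scale using 1 by (simp add: k_def)
      ultimately show ?thesis using that[of v "\<lambda>i. w i + k * v i"] basis by simp
    next
      case 2
      define k where "k = - tri T p w v / tri T p w w"
      have "det3 p w (\<lambda>i. v i + k * w i) = - det3 p v w" by (simp add: det3_def algebra_simps)
      moreover have "tri T p w (\<lambda>i. v i + k * w i) = 0" unfolding tri_add tri_scale using 2 by (simp add: k_def)
      ultimately show ?thesis using that[of w "\<lambda>i. v i + k * w i"] basis by simp
    next
      case 3
      have "det3 p (\<lambda>i. v i + w i) (\<lambda>i. v i + (- 1) * w i) = - 2 * det3 p v w"
        by (simp add: det3_def algebra_simps)
      moreover have "tri T p (\<lambda>i. v i + w i) (\<lambda>i. v i + (- 1) * w i) = 0"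
        unfolding tri_add tri_scale using 3 sym(2)[of p w v] by simp
      ultimately show ?thesis using that[of "\<lambda>i. v i + w i" "\<lambda>i. v i + (- 1) * w i"] basis by simp
    qed
  qed
  have z: "tri T p s p = 0" "tri T p s' p = 0" "tri T s p p = 0" "tri T s' p p = 0" "tri T p s' s = 0"
    "tri T s s' p = 0" "tri T s p s' = 0"
    using pp o sym(2)[of p s p] sym(2)[of p s' p] sym(1)[of s p p] sym(1)[of s' p p] sym(2)[of p s' s]
      sym(2)[of s s' p] sym(1)[of s p s'] by simp_all
  consider "tri T p s s = 0" | "tri T p s' s' = 0" | "tri T p s s \<noteq> 0" "tri T p s' s' \<noteq> 0" by blast
  then show ?thesis
  proof cases
    case 1
    have "tri T p s q = 0" for q by (rule tri_eq_0_basis[OF b z(1) 1 o])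
    then show ?thesis using split[OF b] by blast
  next
    case 2
    have "tri T p s' q = 0" for q by (rule tri_eq_0_basis[OF b z(2) z(5) 2])
    moreover have "det3 p s' s \<noteq> 0" using b det3_swap[of p s' s] by simp
    ultimately show ?thesis using split by blast
  next
    case 3
    \<comment> \<open>The multiples of p are chosen to cancel F(s, s', s') and F(s, s', s); F(?p,
      ?v, p) vanishes anyway.\<close>
    define l where "l = - tri T s s' s' / tri T p s' s'"
    define m where "m = - tri T s s' s / tri T p s s"
    let ?p = "\<lambda>i. s i + l * p i" and ?v = "\<lambda>i. s' i + m * p i"
    have "tri T ?p ?v p = 0"
      unfolding tri_add tri_scale using z pp by simp
    moreover have "tri T ?p ?v s = 0"
      unfolding tri_add tri_scale using 3 z pp sym(1)[of s p s] by (simp add: m_def)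
    moreover have "tri T ?p ?v s' = 0"
      unfolding tri_add tri_scale using 3 z pp by (simp add: l_def)
    ultimately have "tri T ?p ?v q = 0" for q by (rule tri_eq_0_basis[OF b])
    moreover have "det3 ?p ?v p = det3 p s s'" by (simp add: det3_def algebra_simps)
    then have "det3 ?p ?v p \<noteq> 0" using b by simp
    ultimately show ?thesis using split by blast
  qed
qed

section \<open>Kernels, pencils and bases in dimension three\<close>

lemma det3_kernel:
  fixes r :: "3 \<Rightarrow> 3 \<Rightarrow> complex"
  assumes "det3 (r 1) (r 2) (r 3) = 0"
  obtains v i where "v i \<noteq> 0" "\<And>j. (\<Sum>k\<in>UNIV. r j k * v k) = 0"
proof -
  define A :: "complex ^ 3 ^ 3" where "A = (\<chi> j k. r j k)"
  have "det A = 0" using assms by (simp add: A_def det_3 det3_def algebra_simps)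
  then have "\<not> (\<exists>B. B ** A = mat 1)"
    using invertible_det_nz invertible_left_inverse by blast
  then obtain x where x: "A *v x = 0" "x \<noteq> 0" unfolding matrix_left_invertible_ker by blast
  from x(2) obtain i where "x $ i \<noteq> 0" by (auto simp: vec_eq_iff)
  moreover have "(\<Sum>k\<in>UNIV. r j k * x $ k) = 0" for j
    using arg_cong[OF x(1), of "\<lambda>y. y $ j"] by (simp add: A_def matrix_vector_mult_def)
  ultimately show ?thesis using that by blast
qed

text \<open>If a is nonsingular, det(s a + b) is a polynomial of degree 3 in s and has a complex
  root; otherwise s = 1, t = 0 works.\<close>

lemma singular_in_pencil:
  fixes a b :: "3 \<Rightarrow> 3 \<Rightarrow> complex"
  obtains s t where "s \<noteq> 0 \<or> t \<noteq> 0"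
    "det3 (\<lambda>k. s * a 1 k + t * b 1 k) (\<lambda>k. s * a 2 k + t * b 2 k) (\<lambda>k. s * a 3 k + t * b 3 k) = 0"
proof (cases "det3 (a 1) (a 2) (a 3) = 0")
  case True
  then show ?thesis using that[of 1 0] by simp
next
  case False
  \<comment> \<open>Multilinear expansion by rows: \<open>?c1\<close> collects the terms with one
    row from a, \<open>?c2\<close> those with two.\<close>
  let ?c1 = "det3 (a 1) (b 2) (b 3) + det3 (b 1) (a 2) (b 3) + det3 (b 1) (b 2) (a 3)"
  let ?c2 = "det3 (a 1) (a 2) (b 3) + det3 (a 1) (b 2) (a 3) + det3 (b 1) (a 2) (a 3)"
  let ?p = "[:det3 (b 1) (b 2) (b 3), ?c1, ?c2, det3 (a 1) (a 2) (a 3):]"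
  have "degree ?p > 0" using False by simp
  then obtain s where s: "poly ?p s = 0" using alg_closed_imp_poly_has_root by blast
  have "det3 (\<lambda>k. s * a 1 k + 1 * b 1 k) (\<lambda>k. s * a 2 k + 1 * b 2 k) (\<lambda>k. s * a 3 k + 1 * b 3 k) = poly ?p s"
    by (simp add: det3_def algebra_simps)
  then show ?thesis using that[of s 1] s by simp
qed

lemma det3_completion:
  fixes p :: "3 \<Rightarrow> complex"
  assumes "p i \<noteq> 0"
  obtains v w where "det3 p v w \<noteq> 0"
proof -
  define e :: "3 \<Rightarrow> 3 \<Rightarrow> complex" where "e = (\<lambda>j k. if j = k then 1 else 0)"
  have "det3 p (e 2) (e 3) = p 1" "det3 p (e 3) (e 1) = p 2" "det3 p (e 1) (e 2) = p 3"
    by (simp_all add: det3_def e_def)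
  then show ?thesis using assms exhaust_3[of i] that by metis
qed

lemma det3_eq_0_parallel:
  fixes p v :: "3 \<Rightarrow> complex"
  assumes "p i \<noteq> 0" "\<And>w. det3 p v w = 0"
  obtains c where "v = (\<lambda>j. c * p j)"
proof -
  define e :: "3 \<Rightarrow> 3 \<Rightarrow> complex" where "e = (\<lambda>j k. if j = k then 1 else 0)"
  have *: "p 2 * v 3 = p 3 * v 2" "p 3 * v 1 = p 1 * v 3" "p 1 * v 2 = p 2 * v 1"
    using assms(2)[of "e 1"] assms(2)[of "e 2"] assms(2)[of "e 3"]
    by (simp_all add: det3_def e_def)
  have "v j = v i / p i * p j" for j
    using * assms(1) exhaust_3[of i] exhaust_3[of j] by (auto simp: field_simps)
  then show ?thesis using that by blast
qed

lemma tri_four_cubes: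
  fixes f :: pol and T :: "3 \<Rightarrow> 3 \<Rightarrow> 3 \<Rightarrow> complex"
  assumes T: "symmetric_tensor T" and x: "\<And>i. ternary_form 1 (x i)"
    and f: "f = tri (\<lambda>i j k. Const (T i j k)) x x x"
  shows "sum_of_four_cubes f \<or> aronhold_S f = 0"
proof -
  obtain s t where st: "s \<noteq> 0 \<or> t \<noteq> 0"
    and det: "det3 (\<lambda>k. s * T 1 1 k + t * T 2 1 k) (\<lambda>k. s * T 1 2 k + t * T 2 2 k)
      (\<lambda>k. s * T 1 3 k + t * T 2 3 k) = 0"
    using singular_in_pencil[of "T 1" "T 2"] by blast
  \<comment> \<open>The matrix of F(p, -, -) for the point p = (s, t, 0); its kernel vector v
    satisfies F(p, v, -) = 0.\<close>
  define r where "r = (\<lambda>j k. s * T 1 j k + t * T 2 j k)"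
  define p where "p = (\<lambda>i::3. if i = 1 then s else if i = 2 then t else 0)"
  have "det3 (r 1) (r 2) (r 3) = 0" using det by (simp add: r_def)
  then obtain v j where v: "v j \<noteq> 0" "\<And>j. (\<Sum>k\<in>UNIV. r j k * v k) = 0"
    using det3_kernel by blast
  have "tri T p q v = (\<Sum>j\<in>UNIV. q j * (\<Sum>k\<in>UNIV. r j k * v k))" for q
    by (simp add: tri_def sum_3 p_def r_def algebra_simps)
  then have pv: "tri T p v q = 0" for q
    using v(2) tri_commute(2)[OF T, of p v q] by simp
  obtain i where pi: "p i \<noteq> 0"
    using st by (cases "s = 0") (auto simp: p_def intro: that[of 1] that[of 2])
  show ?thesis
  proof (cases "\<exists>w. det3 p v w \<noteq> 0")
    case True
    then show ?thesis using tri_split_basis[OF T x f _ pv] by blast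
  next
    case False
    then obtain c where c: "v = (\<lambda>j. c * p j)" using det3_eq_0_parallel[of p i v] pi by blast
    then have "c \<noteq> 0" using v(1) by auto
    then have "tri T p p q = 0" for q using pv[of q] unfolding c tri_scale by simp
    moreover obtain v' w' where "det3 p v' w' \<noteq> 0" using det3_completion[of p i] pi by blast
    ultimately show ?thesis using tri_singular_point[OF T x f] by blast
  qed
qed

lemma ternary_cubic_tensor:
  assumes "ternary_form 3 f"
  obtains T where "symmetric_tensor T"
    "f = tri (\<lambda>i j k. Const (T i j k)) (\<lambda>i. Var (X i)) (\<lambda>i. Var (X i)) (\<lambda>i. Var (X i))"
proof -
  define g :: "nat \<Rightarrow> nat \<Rightarrow> nat \<Rightarrow> complex" where
    "g = (\<lambda>i j k. Poly_Mapping.lookup f (monom3 X i j k) * fact i * fact j * fact k / 6)"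
  \<comment> \<open>The number of indices equal to l. An entry of \<open>T\<close> depends only on
    these counts, hence the symmetry; \<open>g\<close> is the coefficient of f divided by its
    multinomial coefficient.\<close>
  define n where "n = (\<lambda>l i j k::3. of_bool (i = l) + of_bool (j = l) + of_bool (k = l) :: nat)"
  define T where "T = (\<lambda>i j k. g (n 1 i j k) (n 2 i j k) (n 3 i j k))"
  have "symmetric_tensor T"
    by (simp add: symmetric_tensor_def T_def n_def add_ac)
  have l: "Poly_Mapping.lookup f (monom3 X 3 0 0) = g 3 0 0"
    "Poly_Mapping.lookup f (monom3 X 0 3 0) = g 0 3 0" "Poly_Mapping.lookup f (monom3 X 0 0 3) = g 0 0 3"
    "Poly_Mapping.lookup f (monom3 X 2 1 0) = 3 * g 2 1 0" "Poly_Mapping.lookup f (monom3 X 2 0 1) = 3 * g 2 0 1"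
    "Poly_Mapping.lookup f (monom3 X 1 2 0) = 3 * g 1 2 0" "Poly_Mapping.lookup f (monom3 X 0 2 1) = 3 * g 0 2 1"
    "Poly_Mapping.lookup f (monom3 X 1 0 2) = 3 * g 1 0 2" "Poly_Mapping.lookup f (monom3 X 0 1 2) = 3 * g 0 1 2"
    "Poly_Mapping.lookup f (monom3 X 1 1 1) = 6 * g 1 1 1"
    by (simp_all add: g_def fact_numeral)
  have "f = (\<Sum>(i, j, k) \<in> {(3,0,0), (0,3,0), (0,0,3), (2,1,0), (2,0,1), (1,2,0), (0,2,1), (1,0,2), (0,1,2), (1,1,1)}.
    Const (Poly_Mapping.lookup f (monom3 X i j k)) * Var (X 1) ^ i * Var (X 2) ^ j * Var (X 3) ^ k)"
    using ternary_form_expand[OF assms] unfolding triples_3 by blast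
  also have "\<dots> = tri (\<lambda>i j k. Const (T i j k)) (\<lambda>i. Var (X i)) (\<lambda>i. Var (X i)) (\<lambda>i. Var (X i))"
    by (simp add: l[simplified] tri_def sum_3 T_def n_def Const_mult numeral_2_eq_2[symmetric] numeral_3_eq_3[symmetric]
         power2_eq_square power3_eq_cube algebra_simps)
  finally show ?thesis using \<open>symmetric_tensor T\<close> that by blast
qed

section \<open>Linear independence and Waring rank\<close>

lemma independent3_lin: "independent3 (lin a) (lin b) (lin c) \<longleftrightarrow> bracket a b c \<noteq> 0"
proof -
  \<comment> \<open>With a, b, c as columns, a kernel vector lists the coefficients of a linear
    relation.\<close>
  define r where "r = (\<lambda>j k::3. if k = 1 then a$j else if k = 2 then b$j else c$j)"
  have s: "(\<Sum>k\<in>UNIV. r j k * v k) = v 1 * a$j + v 2 * b$j + v 3 * c$j" for j v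
    by (simp add: sum_3 r_def)
  have d: "det3 (r 1) (r 2) (r 3) = bracket a b c"
    by (simp add: det3_def r_def algebra_simps)
  have comb: "Const \<alpha> * lin a + Const \<beta> * lin b + Const \<gamma> * lin c = lin (\<alpha> *s a + \<beta> *s b + \<gamma> *s c)" for \<alpha> \<beta> \<gamma>
    by (simp add: lin_add lin_scale)
  show ?thesis
  proof
    assume ind: "independent3 (lin a) (lin b) (lin c)"
    show "bracket a b c \<noteq> 0"
    proof
      assume "bracket a b c = 0"
      then have "det3 (r 1) (r 2) (r 3) = 0" unfolding d .
      then obtain v i where v: "v i \<noteq> 0" "\<And>j. (\<Sum>k\<in>UNIV. r j k * v k) = 0"
        using det3_kernel by blast
      then have "Const (v 1) * lin a + Const (v 2) * lin b + Const (v 3) * lin c = 0"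
        unfolding comb lin_eq_0_iff s by (simp add: vec_eq_iff)
      then have "v 1 = 0 \<and> v 2 = 0 \<and> v 3 = 0" using ind unfolding independent3_def by blast
      then show False using v(1) exhaust_3[of i] by auto
    qed
  next
    assume nz: "bracket a b c \<noteq> 0"
    show "independent3 (lin a) (lin b) (lin c)"
      unfolding independent3_def comb lin_eq_0_iff
    proof (intro allI impI)
      fix \<alpha> \<beta> \<gamma> assume "\<alpha> *s a + \<beta> *s b + \<gamma> *s c = 0"
      then have e: "\<alpha> * a$i + \<beta> * b$i + \<gamma> * c$i = 0" for i
        by (simp add: vec_eq_iff)
      \<comment> \<open>Replacing one row by the whole combination only multiplies the determinant
        by the corresponding coefficient.\<close>
      have "\<alpha> * bracket a b c = det3 (\<lambda>i. \<alpha> * a$i + \<beta> * b$i + \<gamma> * c$i) (($) b) (($) c)"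
        "\<beta> * bracket a b c = det3 (($) a) (\<lambda>i. \<alpha> * a$i + \<beta> * b$i + \<gamma> * c$i) (($) c)"
        "\<gamma> * bracket a b c = det3 (($) a) (($) b) (\<lambda>i. \<alpha> * a$i + \<beta> * b$i + \<gamma> * c$i)"
        by (simp_all add: det3_def algebra_simps)
      then show "\<alpha> = 0 \<and> \<beta> = 0 \<and> \<gamma> = 0"
        unfolding e using nz by (simp add: det3_def)
    qed
  qed
qed

lemma aronhold_S_triplewise_independent:
  assumes "ternary_form 1 a" "ternary_form 1 b" "ternary_form 1 c" "ternary_form 1 d"
  shows "aronhold_S (a ^ 3 + b ^ 3 + c ^ 3 + d ^ 3) \<noteq> 0 \<longleftrightarrow> triplewise_independent a b c d"
proof -
  obtain va vb vc vd where "a = lin va" "b = lin vb" "c = lin vc" "d = lin vd"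
    using assms unfolding ternary_form_1_iff by blast
  then show ?thesis
    by (simp add: aronhold_S_four_cubes triplewise_independent_def independent3_lin)
qed

lemma waring_rank_four:
  assumes f: "f = a ^ 3 + b ^ 3 + c ^ 3 + d ^ 3"
    and forms: "ternary_form 1 a" "ternary_form 1 b" "ternary_form 1 c" "ternary_form 1 d"
    and S: "aronhold_S f \<noteq> 0"
  shows "waring_rank 3 f = 4"
  unfolding waring_rank_def
proof (rule Least_equality)
  let ?l = "\<lambda>i::nat. if i = 0 then a else if i = 1 then b else if i = 2 then c else d"
  have "f = (\<Sum>i<4. ?l i ^ 3)" unfolding f by (simp add: numeral_eq_Suc)
  moreover have "\<forall>i<4. ternary_form 1 (?l i)" using forms by simp
  ultimately show "\<exists>l::nat \<Rightarrow> pol. (\<forall>i<4. ternary_form 1 (l i)) \<and> f = (\<Sum>i<4. l i ^ 3)"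
    by (intro exI[of _ ?l] conjI)
next
  fix r assume "\<exists>l::nat \<Rightarrow> pol. (\<forall>i<r. ternary_form 1 (l i)) \<and> f = (\<Sum>i<r. l i ^ 3)"
  then obtain l where l: "\<And>i. i < r \<Longrightarrow> ternary_form 1 (l i)" "f = (\<Sum>i<r. l i ^ 3)" by blast
  show "4 \<le> r"
  proof (rule ccontr)
    assume "\<not> 4 \<le> r"
    then have r: "r \<le> 3" by simp
    \<comment> \<open>Fewer than four cubes are padded with zero forms, so that the fourth form is
      0; S being nonzero would then make 0 part of an independent triple.\<close>
    define l' where "l' = (\<lambda>i. if i < r then l i else 0)"
    have form: "ternary_form 1 (l' i)" for i using l(1) by (simp add: l'_def)
    have "f = (\<Sum>i<3. l' i ^ 3)"
      unfolding l(2) using r by (intro sum.mono_neutral_cong_left) (auto simp: l'_def)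
    also have "\<dots> = l' 0 ^ 3 + l' 1 ^ 3 + l' 2 ^ 3 + 0 ^ 3"
      by (simp add: numeral_eq_Suc)
    finally have "triplewise_independent (l' 0) (l' 1) (l' 2) 0"
      using S aronhold_S_triplewise_independent[OF form form form ternary_form_0] by metis
    then have "independent3 (l' 0) (l' 1) 0" by (simp add: triplewise_independent_def)
    then show False unfolding independent3_def by (metis add_0 mult_zero_left mult_zero_right Const_0 one_neq_zero)
  qed
qed

theorem lemma5p18:
  fixes f :: pol
  assumes "ternary_form 3 f"
  shows "(aronhold_S f \<noteq> 0 \<longleftrightarrow>
           (\<exists>a b c d. ternary_form 1 a \<and> ternary_form 1 b \<and> ternary_form 1 c \<and> ternary_form 1 d \<and>
              triplewise_independent a b c d \<and> f = a ^ 3 + b ^ 3 + c ^ 3 + d ^ 3))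
       \<and> (aronhold_S f \<noteq> 0 \<longrightarrow> waring_rank 3 f = 4)"
proof -
  obtain T where T: "symmetric_tensor T"
    "f = tri (\<lambda>i j k. Const (T i j k)) (\<lambda>i. Var (X i)) (\<lambda>i. Var (X i)) (\<lambda>i. Var (X i))"
    using ternary_cubic_tensor[OF assms] by blast
  have "ternary_form 1 (Var (X i))" for i
    using ternary_form_Var[of i] exhaust_3[of i] by auto
  then have four: "sum_of_four_cubes f" if "aronhold_S f \<noteq> 0"
    using that tri_four_cubes[OF T(1) _ T(2)] by blast
  show ?thesis
  proof (intro conjI iffI impI)
    assume S: "aronhold_S f \<noteq> 0"
    then show "\<exists>a b c d. ternary_form 1 a \<and> ternary_form 1 b \<and> ternary_form 1 c \<and> ternary_form 1 d \<and>
              triplewise_independent a b c d \<and> f = a ^ 3 + b ^ 3 + c ^ 3 + d ^ 3"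
      using four aronhold_S_triplewise_independent unfolding sum_of_four_cubes_def by metis
    show "waring_rank 3 f = 4"
      using four S waring_rank_four unfolding sum_of_four_cubes_def by metis
  next
    assume "\<exists>a b c d. ternary_form 1 a \<and> ternary_form 1 b \<and> ternary_form 1 c \<and> ternary_form 1 d \<and>
              triplewise_independent a b c d \<and> f = a ^ 3 + b ^ 3 + c ^ 3 + d ^ 3"
    then show "aronhold_S f \<noteq> 0" using aronhold_S_triplewise_independent by metis
  qed
qed

end
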